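(* Let $X$ and $Y$ be independent, positive, non-degenerate random variables. If the random variables $$U=\frac{1+\frac{1}{X+Y}}{1+\frac{1}{X}}\qquad\text{and}\qquad V=X+Y$$ are independent, then $X$ has a Kummer distribution and $Y$ has a gamma distribution.
   Context: A Kummer distribution is a distribution $\mathcal{K}(a,b,c)$ for some $a>0$, $b\in\mathbb{R}$, $c>0$, i.e. the probability distribution on $(0,\infty)$ with density proportional to $\dfrac{x^{a-1}e^{-cx}}{(1+x)^{a+b}}\,I_{(0,\infty)}(x)$. A gamma distribution is a distribution $\mathcal{G}(b,c)$ for some $b,c>0$, i.e. the probability distribution on $(0,\infty)$ with density proportional to $y^{b-1}e^{-cy}I_{(0,\infty)}(y)$. A random variable is non-degenerate if it is not almost surely constant. *)

theory Defs
  imports "HOL-Probability.Probability"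
begin

definition kummer_kernel :: "real \<Rightarrow> real \<Rightarrow> real \<Rightarrow> real \<Rightarrow> real" where
  "kummer_kernel a b c x =
     x powr (a - 1) * exp (- c * x) / (1 + x) powr (a + b) * indicator {0<..} x"

definition gamma_kernel :: "real \<Rightarrow> real \<Rightarrow> real \<Rightarrow> real" where
  "gamma_kernel b c y = y powr (b - 1) * exp (- c * y) * indicator {0<..} y"

(* The factor C is the normalising constant; prob_space determines it uniquely. *)
definition prob_density_proportional_to :: "real measure \<Rightarrow> (real \<Rightarrow> real) \<Rightarrow> bool" where
  "prob_density_proportional_to \<mu> k \<longleftrightarrow>
     prob_space \<mu> \<and> (\<exists>C>0. \<mu> = density lborel (\<lambda>x. ennreal (C * k x)))"

definition kummer_distribution :: "real measure \<Rightarrow> bool" where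
  "kummer_distribution \<mu> \<longleftrightarrow>
     (\<exists>a b c. a > 0 \<and> c > 0 \<and> prob_density_proportional_to \<mu> (kummer_kernel a b c))"

definition gamma_distribution :: "real measure \<Rightarrow> bool" where
  "gamma_distribution \<mu> \<longleftrightarrow>
     (\<exists>b c. b > 0 \<and> c > 0 \<and> prob_density_proportional_to \<mu> (gamma_kernel b c))"

definition non_degenerate :: "'a measure \<Rightarrow> ('a \<Rightarrow> real) \<Rightarrow> bool" where
  "non_degenerate M X \<longleftrightarrow> \<not> (\<exists>c. AE \<omega> in M. X \<omega> = c)"

end

theory Submission
  imports Defs "HOL-Real_Asymp.Real_Asymp"
begin

text \<open>
  Since \<open>X / (1 + X) = U V / (1 + V)\<close>, each of \<open>X ^ j / (1 + X)\<^sup>2\<close> with \<open>j \<le> 2\<close> is a polynomial in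
  \<open>U\<close> with coefficients in the span of \<open>V ^ i / (1 + V)\<^sup>2\<close>, \<open>i \<le> 2\<close>. Multiplying by
  \<open>exp (- s V) = exp (- s X) exp (- s Y)\<close> and taking expectations, the two independence assumptions
  give three linear relations between the Laplace transforms of \<open>X\<close> and \<open>V\<close> with these weights, which
  are successive derivatives of each other up to sign, and the Laplace transform \<open>F\<close> of \<open>Y\<close>.
  Differentiating and eliminating the transforms of \<open>V\<close> shows that \<open>r = - F' / F\<close> satisfies
  \<open>r' = - \<kappa> r\<^sup>2\<close> with \<open>\<kappa> > 0\<close>, so \<open>F\<close> is the transform of a gamma law. Eliminating them in another way
  leaves a linear second order equation for the transform of \<open>X / (1 + X)\<^sup>2\<close>, which the Kummer
  kernel also satisfies. A growth estimate for the Wronskian shows that its bounded solutions are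
  proportional, and uniqueness of Laplace transforms identifies the law of \<open>X\<close>.
\<close>

section \<open>Laplace transforms\<close>

text \<open>The Lagrange form of the second order Maclaurin remainder, with the factor 1/2 dropped;
  it controls difference quotients of \<open>exp (- (s * Z))\<close> in \<open>s\<close>.\<close>

lemma exp_quadratic_remainder:
  fixes y :: real
  shows "\<bar>exp y - 1 - y\<bar> \<le> y\<^sup>2 * exp \<bar>y\<bar>"
proof -
  obtain t where t: "\<bar>t\<bar> \<le> \<bar>y\<bar>" "exp y = (\<Sum>m<2. y ^ m / fact m) + exp t / fact 2 * y ^ 2"
    using Maclaurin_exp_le[of y 2] by blast
  have eq: "exp y - 1 - y = exp t / 2 * y\<^sup>2"
    using t(2) by (simp add: lessThan_nat_numeral)
  have "exp t / 2 \<le> exp t" by simp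
  also have "exp t \<le> exp \<bar>y\<bar>"
    using t(1) by simp
  finally have "exp t / 2 * y\<^sup>2 \<le> exp \<bar>y\<bar> * y\<^sup>2"
    by (rule mult_right_mono) simp
  then show ?thesis
    unfolding eq by (simp add: mult.commute)
qed

text \<open>Half of the exponential absorbs the factor \<open>Z\<close>, as
  \<open>z * exp (- (s * z)) \<le> 2 / s * exp (- (s / 2 * z))\<close> for \<open>z \<ge> 0\<close>;
  the other half is handled by \<open>int\<close> at \<open>s / 2\<close>.\<close>

lemma integrable_mult_exp:
  fixes f Z :: "'a \<Rightarrow> real"
  assumes [measurable]: "f \<in> borel_measurable M" "Z \<in> borel_measurable M"
    and nn: "AE \<omega> in M. 0 \<le> Z \<omega>"
    and int: "\<And>s. s > 0 \<Longrightarrow> integrable M (\<lambda>\<omega>. f \<omega> * exp (- (s * Z \<omega>)))"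
    and s: "s > 0"
  shows "integrable M (\<lambda>\<omega>. (Z \<omega> * f \<omega>) * exp (- (s * Z \<omega>)))"
proof (rule Bochner_Integration.integrable_bound)
  show "integrable M (\<lambda>\<omega>. 2 / s * (f \<omega> * exp (- (s / 2 * Z \<omega>))))"
    using int[of "s / 2"] s by simp
  show "AE \<omega> in M. norm ((Z \<omega> * f \<omega>) * exp (- (s * Z \<omega>)))
      \<le> norm (2 / s * (f \<omega> * exp (- (s / 2 * Z \<omega>))))"
    using nn
  proof eventually_elim
    case (elim \<omega>)
    define z where "z = Z \<omega>"
    have z: "z \<ge> 0" using elim by (simp add: z_def)
    have "s / 2 * z \<le> exp (s / 2 * z)"
      using exp_ge_add_one_self[of "s / 2 * z"] by linarith
    then have "s / 2 * z * exp (- (s * z)) \<le> exp (s / 2 * z) * exp (- (s * z))"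
      by (rule mult_right_mono) simp
    also have "\<dots> = exp (- (s / 2 * z))"
      by (simp flip: exp_add)
    finally have "z * exp (- (s * z)) \<le> 2 / s * exp (- (s / 2 * z))"
      using s by (simp add: field_simps)
    then have "\<bar>f \<omega>\<bar> * (z * exp (- (s * z))) \<le> \<bar>f \<omega>\<bar> * (2 / s * exp (- (s / 2 * z)))"
      by (rule mult_left_mono) simp
    then show ?case
      using s z by (simp add: abs_mult z_def mult_ac)
  qed
qed measurable

text \<open>Differentiation under the integral with an explicit rate: by the quadratic remainder,
  the difference quotient deviates from \<open>- D\<close> by at most
  \<open>C * \<bar>h\<bar>\<close>.\<close>

lemma DERIV_laplace:
  fixes f Z :: "'a \<Rightarrow> real"
  assumes [measurable]: "f \<in> borel_measurable M" "Z \<in> borel_measurable M"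
    and nn: "AE \<omega> in M. 0 \<le> Z \<omega>"
    and int: "\<And>s. s > 0 \<Longrightarrow> integrable M (\<lambda>\<omega>. f \<omega> * exp (- (s * Z \<omega>)))"
    and s: "s > 0"
  shows "((\<lambda>s. \<integral>\<omega>. f \<omega> * exp (- (s * Z \<omega>)) \<partial>M) has_real_derivative
           - (\<integral>\<omega>. (Z \<omega> * f \<omega>) * exp (- (s * Z \<omega>)) \<partial>M)) (at s)"
proof -
  define F where "F s = (\<integral>\<omega>. f \<omega> * exp (- (s * Z \<omega>)) \<partial>M)" for s
  define D where "D = (\<integral>\<omega>. (Z \<omega> * f \<omega>) * exp (- (s * Z \<omega>)) \<partial>M)"
  have int1: "integrable M (\<lambda>\<omega>. (Z \<omega> * f \<omega>) * exp (- (s * Z \<omega>)))" if "s > 0" for s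
    by (rule integrable_mult_exp[OF assms(1-4) that])
  have int2: "integrable M (\<lambda>\<omega>. (Z \<omega> * (Z \<omega> * f \<omega>)) * exp (- (s * Z \<omega>)))" if "s > 0" for s
    by (rule integrable_mult_exp[OF _ _ nn int1 that]) measurable
  \<comment> \<open>The remainder contributes \<open>exp (\<bar>h\<bar> * Z)\<close>; for
    \<open>\<bar>h\<bar> < s / 2\<close> a decay of rate at least \<open>s / 2\<close> is left
    over.\<close>
  define C where "C = (\<integral>\<omega>. \<bar>(Z \<omega> * (Z \<omega> * f \<omega>)) * exp (- (s / 2 * Z \<omega>))\<bar> \<partial>M)"
  have bound: "\<bar>(F (s + h) - F s) / h + D\<bar> \<le> C * \<bar>h\<bar>" if h: "h \<noteq> 0" "\<bar>h\<bar> < s / 2" for h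
  proof -
    define G where "G \<omega> = f \<omega> * exp (- ((s + h) * Z \<omega>)) - f \<omega> * exp (- (s * Z \<omega>))
        + h * ((Z \<omega> * f \<omega>) * exp (- (s * Z \<omega>)))" for \<omega>
    have sh: "s + h > 0" using h s by linarith
    have intG: "integrable M G"
      unfolding G_def
      by (intro Bochner_Integration.integrable_add Bochner_Integration.integrable_diff
          integrable_mult_right int int1 s sh)
    have "F (s + h) - F s + h * D = integral\<^sup>L M G"
      unfolding G_def F_def D_def using int[OF s] int[OF sh] int1[OF s] by simp
    also have "\<bar>\<dots>\<bar> \<le> (\<integral>\<omega>. h\<^sup>2 * \<bar>(Z \<omega> * (Z \<omega> * f \<omega>)) * exp (- (s / 2 * Z \<omega>))\<bar> \<partial>M)"
    proof -
      have "\<bar>integral\<^sup>L M G\<bar> \<le> (\<integral>\<omega>. \<bar>G \<omega>\<bar> \<partial>M)"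
        by (rule integral_abs_bound)
      also have "\<dots> \<le> (\<integral>\<omega>. h\<^sup>2 * \<bar>(Z \<omega> * (Z \<omega> * f \<omega>)) * exp (- (s / 2 * Z \<omega>))\<bar> \<partial>M)"
      proof (rule integral_mono_AE)
        show "integrable M (\<lambda>\<omega>. \<bar>G \<omega>\<bar>)" using intG by simp
        show "integrable M (\<lambda>\<omega>. h\<^sup>2 * \<bar>(Z \<omega> * (Z \<omega> * f \<omega>)) * exp (- (s / 2 * Z \<omega>))\<bar>)"
          using int2[of "s / 2"] s by simp
        show "AE \<omega> in M. \<bar>G \<omega>\<bar> \<le> h\<^sup>2 * \<bar>(Z \<omega> * (Z \<omega> * f \<omega>)) * exp (- (s / 2 * Z \<omega>))\<bar>"
          using nn
        proof eventually_elim
          case (elim \<omega>)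
          define z where "z = Z \<omega>"
          have z: "z \<ge> 0" using elim by (simp add: z_def)
          have "exp (- ((s + h) * z)) = exp (- (s * z)) * exp (- (h * z))"
            by (simp add: algebra_simps flip: exp_add)
          then have "G \<omega> = f \<omega> * exp (- (s * z)) * (exp (- (h * z)) - 1 - (- (h * z)))"
            unfolding G_def z_def by (simp add: algebra_simps)
          then have "\<bar>G \<omega>\<bar> = \<bar>f \<omega>\<bar> * exp (- (s * z)) * \<bar>exp (- (h * z)) - 1 - (- (h * z))\<bar>"
            by (simp add: abs_mult)
          also have "\<dots> \<le> \<bar>f \<omega>\<bar> * exp (- (s * z)) * ((- (h * z))\<^sup>2 * exp \<bar>- (h * z)\<bar>)"
            by (intro mult_left_mono exp_quadratic_remainder) simp
          also have "\<dots> = h\<^sup>2 * (z * (z * \<bar>f \<omega>\<bar>)) * exp (\<bar>h\<bar> * z - s * z)"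
            using z by (simp add: abs_mult power2_eq_square exp_diff exp_minus field_simps)
          also have "\<dots> \<le> h\<^sup>2 * (z * (z * \<bar>f \<omega>\<bar>)) * exp (- (s / 2 * z))"
          proof (intro mult_left_mono)
            have "\<bar>h\<bar> * z \<le> s / 2 * z" using h z by (intro mult_right_mono) auto
            then show "exp (\<bar>h\<bar> * z - s * z) \<le> exp (- (s / 2 * z))"
              by (simp add: algebra_simps)
          qed (use z in auto)
          finally show ?case
            using z by (simp add: abs_mult z_def mult_ac)
        qed
      qed
      finally show ?thesis .
    qed
    also have "\<dots> = h\<^sup>2 * C" by (simp add: C_def)
    finally have "\<bar>F (s + h) - F s + h * D\<bar> \<le> h\<^sup>2 * C" .
    moreover have "(F (s + h) - F s) / h + D = (F (s + h) - F s + h * D) / h"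
      using h by (simp add: field_simps)
    moreover have "h\<^sup>2 * C / \<bar>h\<bar> = C * \<bar>h\<bar>"
      using h by (simp add: power2_eq_square field_simps abs_if)
    ultimately show ?thesis
      using h divide_right_mono[of "\<bar>F (s + h) - F s + h * D\<bar>" "h\<^sup>2 * C" "\<bar>h\<bar>"] by simp
  qed
  have "((\<lambda>h. (F (s + h) - F s) / h + D) \<longlongrightarrow> 0) (at 0)"
  proof (rule Lim_null_comparison)
    show "\<forall>\<^sub>F h in at 0. norm ((F (s + h) - F s) / h + D) \<le> C * \<bar>h\<bar>"
      unfolding eventually_at using bound s
      by (intro exI[of _ "s / 2"]) (auto simp: dist_real_def)
    show "((\<lambda>h. C * \<bar>h\<bar>) \<longlongrightarrow> 0) (at 0)"
      by (auto intro!: tendsto_eq_intros)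
  qed
  then have "((\<lambda>h. (F (s + h) - F s) / h) \<longlongrightarrow> - D) (at 0)"
    using tendsto_diff[OF _ tendsto_const[of D "at 0"]] by fastforce
  then show ?thesis
    unfolding F_def D_def by (simp add: DERIV_def)
qed

text \<open>All absolute moments are at most 1, so the Taylor polynomials of a characteristic
  function converge to it, with error at most \<open>2 * \<bar>t\<bar> ^ n / fact n\<close>. Equal
  moments give equal polynomials, hence equal characteristic functions.\<close>

lemma real_distribution_eq_if_moments_eq:
  assumes "real_distribution \<mu>" "real_distribution \<nu>"
    and "AE x in \<mu>. \<bar>x\<bar> \<le> 1" "AE x in \<nu>. \<bar>x\<bar> \<le> 1"
    and eq: "\<And>k::nat. (\<integral>x. x ^ k \<partial>\<mu>) = (\<integral>x. x ^ k \<partial>\<nu>)"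
  shows "\<mu> = \<nu>"
proof (rule Levy_uniqueness[OF assms(1,2)], rule ext)
  fix t
  have approx: "cmod (char \<rho> t - (\<Sum>k \<le> n. ((\<i> * t)^k / fact k) * (\<integral>x. x ^ k \<partial>\<rho>))) \<le> 2 * \<bar>t\<bar> ^ n / fact n"
    if "real_distribution \<rho>" and le: "AE x in \<rho>. \<bar>x\<bar> \<le> 1" for \<rho> n
  proof -
    interpret real_distribution \<rho> by fact
    have int: "integrable \<rho> (\<lambda>x. x ^ k)" for k :: nat
    proof (rule integrable_const_bound[where B = 1])
      show "AE x in \<rho>. norm (x ^ k) \<le> 1"
        using le by eventually_elim (simp add: power_abs power_le_one)
    qed simp
    have "expectation (\<lambda>x. \<bar>x\<bar> ^ n) \<le> 1"
    proof (rule integral_le_const)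
      show "integrable \<rho> (\<lambda>x. \<bar>x\<bar> ^ n)"
        using integrable_abs[OF int[of n]] by (simp add: power_abs)
      show "AE x in \<rho>. \<bar>x\<bar> ^ n \<le> 1"
        using le by eventually_elim (simp add: power_le_one)
    qed
    then have "2 * \<bar>t\<bar> ^ n / fact n * expectation (\<lambda>x. \<bar>x\<bar> ^ n) \<le> 2 * \<bar>t\<bar> ^ n / fact n * 1"
      by (rule mult_left_mono) simp
    with char_approx1[of n t, OF int] show ?thesis by simp
  qed
  have "cmod (char \<mu> t - char \<nu> t) \<le> 4 * (\<bar>t\<bar> ^ n / fact n)" for n
  proof -
    define S where "S = (\<Sum>k \<le> n. ((\<i> * t)^k / fact k) * (\<integral>x. x ^ k \<partial>\<mu>))"
    have "cmod (char \<mu> t - char \<nu> t) \<le> cmod (char \<mu> t - S) + cmod (char \<nu> t - S)"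
      using norm_triangle_ineq4[of "char \<mu> t - S" "char \<nu> t - S"] by simp
    also have "\<dots> \<le> 2 * \<bar>t\<bar> ^ n / fact n + 2 * \<bar>t\<bar> ^ n / fact n"
      using approx[OF assms(1,3), of n] approx[OF assms(2,4), of n]
      unfolding S_def eq by (intro add_mono)
    finally show ?thesis by simp
  qed
  moreover have "(\<lambda>n. 4 * (\<bar>t\<bar> ^ n / fact n)) \<longlonglongrightarrow> 4 * 0"
    by (intro tendsto_mult tendsto_const summable_LIMSEQ_zero) (use summable_exp[of "\<bar>t\<bar>"] in \<open>simp add: divide_inverse mult.commute\<close>)
  ultimately have "cmod (char \<mu> t - char \<nu> t) \<le> 4 * 0"
    by (intro tendsto_lowerbound[where a = "cmod (char \<mu> t - char \<nu> t)"]) auto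
  then show "char \<mu> t = char \<nu> t" by simp
qed

text \<open>Under \<open>x \<mapsto> exp (- x)\<close> the transform at the positive integers
  becomes a moment sequence on (0, 1), which determines a law. Only \<mu> is assumed to have mass 1;
  that \<nu> has mass 1 comes out of the conclusion, which later spares computing normalising
  constants.\<close>

lemma measure_eq_if_weighted_laplace_eq:
  fixes \<mu> \<nu> :: "real measure" and w :: "real \<Rightarrow> real"
  assumes \<mu>: "prob_space \<mu>" and sets[measurable_cong]: "sets \<mu> = sets borel" "sets \<nu> = sets borel"
    and pos: "AE x in \<mu>. x > 0" "AE x in \<nu>. x > 0"
    and w[measurable]: "w \<in> borel_measurable borel" and w_pos: "\<And>x. x > 0 \<Longrightarrow> w x > 0"
    and int: "\<And>s. s > 0 \<Longrightarrow> integrable \<mu> (\<lambda>x. w x * exp (- (s * x)))"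
      "\<And>s. s > 0 \<Longrightarrow> integrable \<nu> (\<lambda>x. w x * exp (- (s * x)))"
    and eq: "\<And>s. s > 0 \<Longrightarrow> (\<integral>x. w x * exp (- (s * x)) \<partial>\<mu>) = (\<integral>x. w x * exp (- (s * x)) \<partial>\<nu>)"
  shows "\<mu> = \<nu>"
proof -
  interpret \<mu>: prob_space \<mu> by fact
  define T where "T = (\<integral>x. w x * exp (- x) \<partial>\<mu>)"
  have T\<nu>: "T = (\<integral>x. w x * exp (- x) \<partial>\<nu>)"
    using eq[of 1] by (simp add: T_def)
  have T: "T > 0"
  proof -
    have nn: "AE x in \<mu>. 0 \<le> w x * exp (- x)"
      using pos(1) by eventually_elim (simp add: w_pos less_imp_le)
    have "T \<noteq> 0"
    proof
      assume "T = 0"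
      then have "AE x in \<mu>. w x * exp (- x) = 0"
        using integral_nonneg_eq_0_iff_AE[OF _ nn] int(1)[of 1] by (simp add: T_def)
      with pos(1) have "AE x in \<mu>. False"
        by eventually_elim (use w_pos in force)
      then show False by simp
    qed
    moreover have "T \<ge> 0" unfolding T_def by (rule integral_nonneg_AE[OF nn])
    ultimately show ?thesis by simp
  qed
  \<comment> \<open>The factor \<open>exp (- x)\<close> is there because \<open>w\<close> alone may
    fail to be integrable; it shifts the k-th moment to the transform at
    \<open>Suc k\<close>.\<close>
  define v where "v x = w x * exp (- x) / T * indicator {0<..} x" for x
  have v[measurable]: "v \<in> borel_measurable borel" unfolding v_def by measurable
  have v_nn: "v x \<ge> 0" for x
    using T w_pos[of x] by (auto simp: v_def indicator_def less_imp_le)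
  have v_pos: "v x > 0" if "x > 0" for x
    using T w_pos[of x] that by (auto simp: v_def)
  have dist: "real_distribution (distr (density \<rho> v) borel (\<lambda>x. exp (- x)))"
    and le: "AE x in distr (density \<rho> v) borel (\<lambda>x. exp (- x)). \<bar>x\<bar> \<le> 1"
    and mom: "(\<integral>x. x ^ k \<partial>distr (density \<rho> v) borel (\<lambda>x. exp (- x))) = (\<integral>x. w x * exp (- (real (Suc k) * x)) \<partial>\<rho>) / T"
    if [measurable_cong]: "sets \<rho> = sets borel" and pos: "AE x in \<rho>. x > 0"
      and int: "integrable \<rho> (\<lambda>x. w x * exp (- x))"
      and T: "T = (\<integral>x. w x * exp (- x) \<partial>\<rho>)" for \<rho> k
  proof -
    have v_AE: "AE x in \<rho>. v x = w x * exp (- x) / T"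
      using pos by eventually_elim (simp add: v_def)
    have intv: "integrable \<rho> v"
      by (rule integrable_cong_AE_imp[of _ "\<lambda>x. w x * exp (- x) / T"]) (use int v_AE in auto)
    have "integral\<^sup>L \<rho> v = (\<integral>x. w x * exp (- x) / T \<partial>\<rho>)"
      by (rule integral_cong_AE) (use v_AE in auto)
    also have "\<dots> = 1" using \<open>T > 0\<close> by (simp add: T[symmetric])
    finally have "(\<integral>\<^sup>+x. ennreal (v x) \<partial>\<rho>) = 1"
      using nn_integral_eq_integral[OF intv] v_nn by simp
    then have "emeasure (density \<rho> v) (space (density \<rho> v)) = 1"
      using sets_eq_imp_space_eq[OF that(1)] by (simp add: emeasure_density)
    then interpret p: prob_space "density \<rho> v" by (rule prob_spaceI)
    show "real_distribution (distr (density \<rho> v) borel (\<lambda>x. exp (- x)))"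
      by (rule p.real_distribution_distr) measurable
    show "AE x in distr (density \<rho> v) borel (\<lambda>x. exp (- x)). \<bar>x\<bar> \<le> 1"
      using pos by (subst AE_distr_iff) (auto simp: AE_density elim!: eventually_mono)
    have "(\<integral>x. x ^ k \<partial>distr (density \<rho> v) borel (\<lambda>x. exp (- x))) = (\<integral>x. v x * exp (- x) ^ k \<partial>\<rho>)"
      by (subst integral_distr, measurable, subst integral_density) (auto simp: v_nn)
    also have "\<dots> = (\<integral>x. w x * exp (- (real (Suc k) * x)) / T \<partial>\<rho>)"
    proof (rule integral_cong_AE)
      show "AE x in \<rho>. v x * exp (- x) ^ k = w x * exp (- (real (Suc k) * x)) / T"
        using v_AE by eventually_elim
          (simp add: algebra_simps flip: exp_add exp_of_nat_mult)
    qed measurable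
    finally show "(\<integral>x. x ^ k \<partial>distr (density \<rho> v) borel (\<lambda>x. exp (- x))) = (\<integral>x. w x * exp (- (real (Suc k) * x)) \<partial>\<rho>) / T"
      by simp
  qed
  have int1: "integrable \<mu> (\<lambda>x. w x * exp (- x))" "integrable \<nu> (\<lambda>x. w x * exp (- x))"
    using int[of 1] by simp_all
  have "distr (density \<mu> v) borel (\<lambda>x. exp (- x)) = distr (density \<nu> v) borel (\<lambda>x. exp (- x))"
    (is "?\<mu> = ?\<nu>")
  proof (rule real_distribution_eq_if_moments_eq)
    show "(\<integral>x. x ^ k \<partial>?\<mu>) = (\<integral>x. x ^ k \<partial>?\<nu>)" for k :: nat
      using eq[of "real (Suc k)"]
      by (simp only: mom[OF sets(1) pos(1) int1(1) T_def] mom[OF sets(2) pos(2) int1(2) T\<nu>])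
  qed (use dist le sets pos int1 T_def T\<nu> in auto)
  \<comment> \<open>Composing with \<open>- ln\<close> undoes \<open>exp (- x)\<close> and recovers
    the weighted measures; their weight \<open>v\<close> is positive almost everywhere and is then
    divided out.\<close>
  then have "distr ?\<mu> borel (\<lambda>x. - ln x) = distr ?\<nu> borel (\<lambda>x. - ln x)"
    by simp
  then have "density \<mu> v = density \<nu> v"
    by (simp add: distr_distr comp_def distr_id2 sets)
  then have "density (density \<mu> v) (\<lambda>x. ennreal (1 / v x)) = density (density \<nu> v) (\<lambda>x. ennreal (1 / v x))"
    by simp
  moreover have "density (density \<rho> v) (\<lambda>x. ennreal (1 / v x)) = \<rho>"
    if [measurable_cong]: "sets \<rho> = sets borel" and pos: "AE x in \<rho>. x > 0" for \<rho>
  proof -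
    have "density (density \<rho> v) (\<lambda>x. ennreal (1 / v x)) = density \<rho> (\<lambda>x. ennreal (v x) * ennreal (1 / v x))"
      by (rule density_density_eq) measurable
    also have "\<dots> = density \<rho> (\<lambda>_. 1)"
    proof (rule density_cong)
      show "AE x in \<rho>. ennreal (v x) * ennreal (1 / v x) = 1"
        using pos by eventually_elim (use v_pos in \<open>force simp flip: ennreal_mult\<close>)
    qed measurable
    finally show ?thesis by (simp add: density_1)
  qed
  ultimately show ?thesis using sets pos by simp
qed

section \<open>Kummer kernels\<close>

text \<open>Applying \<open>ln y \<le> y - 1\<close> to \<open>y = \<delta> * (1 + x)\<close> bounds
  any power of \<open>1 + x\<close> by an exponential whose rate
  \<open>\<bar>p\<bar> * \<delta>\<close> can be made as small as desired.\<close>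

lemma powr_one_plus_le_exp:
  fixes x p \<delta> :: real
  assumes x: "x \<ge> 0" and \<delta>: "\<delta> > 0"
  shows "(1 + x) powr p \<le> exp (\<bar>p\<bar> * (\<delta> - ln \<delta>)) * exp (\<bar>p\<bar> * \<delta> * x)"
proof -
  have "ln (\<delta> * (1 + x)) \<le> \<delta> * (1 + x) - 1"
    using x \<delta> by (intro ln_le_minus_one) simp
  then have "ln (1 + x) \<le> \<delta> - ln \<delta> + \<delta> * x"
    using x \<delta> by (subst (asm) ln_mult_pos) (auto simp: algebra_simps)
  moreover have "ln (1 + x) \<ge> 0" using x by simp
  ultimately have "p * ln (1 + x) \<le> \<bar>p\<bar> * (\<delta> - ln \<delta> + \<delta> * x)"
    by (meson abs_ge_self abs_ge_zero mult_left_mono mult_right_mono order_trans)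
  then show ?thesis
    using x by (simp add: powr_def algebra_simps flip: exp_add)
qed

text \<open>One family for both laws: \<open>p = 0\<close> gives the gamma kernels and
  \<open>p = - (a + b)\<close> the Kummer kernels. It is closed under multiplication by powers of
  \<open>x\<close>, by \<open>1 + x\<close> and by \<open>exp (- (t * x))\<close>.\<close>

definition kummer_fun :: "real \<Rightarrow> real \<Rightarrow> real \<Rightarrow> real \<Rightarrow> real" where
  "kummer_fun \<alpha> p s x = x powr \<alpha> * (1 + x) powr p * exp (- (s * x)) * indicator {0<..} x"

lemma kummer_fun_measurable [measurable]: "kummer_fun \<alpha> p s \<in> borel_measurable borel"
  unfolding kummer_fun_def by measurable

lemma kummer_fun_nonneg: "0 \<le> kummer_fun \<alpha> p s x"
  by (simp add: kummer_fun_def)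

text \<open>For \<open>s = 1\<close> this is Euler's integral for
  \<open>Gamma (\<alpha> + 1)\<close>; rescaling \<open>x\<close> to \<open>s * x\<close> handles
  the other rates.\<close>

lemma integrable_kummer_fun_0:
  assumes "\<alpha> > -1" "s > 0"
  shows "integrable lborel (kummer_fun \<alpha> 0 s)"
proof -
  have 1: "integrable lborel (kummer_fun \<alpha> 0 1)"
  proof (rule integrableI_nonneg)
    have "(\<integral>\<^sup>+x. ennreal (kummer_fun \<alpha> 0 1 x) \<partial>lborel)
        = (\<integral>\<^sup>+x. ennreal (indicator {0..} x * x powr ((\<alpha> + 1) - 1) / exp x) \<partial>lborel)"
    proof (rule nn_integral_cong_AE)
      show "AE x in lborel. ennreal (kummer_fun \<alpha> 0 1 x)
          = ennreal (indicator {0..} x * x powr ((\<alpha> + 1) - 1) / exp x)"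
        using AE_lborel_singleton[of 0]
        by eventually_elim (auto simp: kummer_fun_def indicator_def exp_minus divide_inverse)
    qed
    also have "\<dots> = ennreal (Gamma (\<alpha> + 1))"
      using assms by (intro Gamma_conv_nn_integral_real[symmetric]) simp
    finally show "(\<integral>\<^sup>+x. ennreal (kummer_fun \<alpha> 0 1 x) \<partial>lborel) < \<infinity>"
      by simp
  qed (auto simp: kummer_fun_nonneg)
  have "integrable lborel (\<lambda>x. kummer_fun \<alpha> 0 1 (0 + s * x))"
    using 1 assms by (intro lborel_integrable_real_affine) auto
  then have "integrable lborel (\<lambda>x. s powr (-\<alpha>) * kummer_fun \<alpha> 0 1 (0 + s * x))"
    by (rule integrable_mult_right)
  also have "(\<lambda>x. s powr (-\<alpha>) * kummer_fun \<alpha> 0 1 (0 + s * x)) = kummer_fun \<alpha> 0 s"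
  proof
    fix x :: real
    show "s powr (-\<alpha>) * kummer_fun \<alpha> 0 1 (0 + s * x) = kummer_fun \<alpha> 0 s x"
    proof (cases "x > 0")
      case True
      then have "s powr (-\<alpha>) * (s * x) powr \<alpha> = x powr \<alpha>"
        using assms by (simp add: powr_mult powr_minus)
      with True show ?thesis
        using assms add_pos_pos[of 1 "s * x"] by (simp add: kummer_fun_def mult.assoc[symmetric])
    next
      case False
      then show ?thesis
        using assms by (simp add: kummer_fun_def zero_less_mult_iff)
    qed
  qed
  finally show ?thesis .
qed

lemma integrable_kummer_fun:
  assumes "\<alpha> > -1" "s > 0"
  shows "integrable lborel (kummer_fun \<alpha> p s)"
proof -
  \<comment> \<open>With this \<delta> the factor \<open>(1 + x) powr p\<close> costs at most half
    of the exponential decay.\<close>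
  define \<delta> where "\<delta> = s / (2 * (\<bar>p\<bar> + 1))"
  have \<delta>: "\<delta> > 0" "\<bar>p\<bar> * \<delta> \<le> s / 2"
    using assms by (auto simp: \<delta>_def field_simps)
  define C where "C = exp (\<bar>p\<bar> * (\<delta> - ln \<delta>))"
  show ?thesis
  proof (rule Bochner_Integration.integrable_bound)
    show "integrable lborel (\<lambda>x. C * kummer_fun \<alpha> 0 (s / 2) x)"
      using integrable_kummer_fun_0[of \<alpha> "s / 2"] assms by simp
    show "AE x in lborel. norm (kummer_fun \<alpha> p s x) \<le> norm (C * kummer_fun \<alpha> 0 (s / 2) x)"
    proof (intro AE_I2)
      fix x :: real
      show "norm (kummer_fun \<alpha> p s x) \<le> norm (C * kummer_fun \<alpha> 0 (s / 2) x)"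
      proof (cases "x > 0")
        case True
        have "(1 + x) powr p \<le> C * exp (\<bar>p\<bar> * \<delta> * x)"
          unfolding C_def using True \<delta> by (intro powr_one_plus_le_exp) auto
        also have "\<dots> \<le> C * exp (s / 2 * x)"
          using True \<delta>(2) by (intro mult_left_mono) (auto simp: C_def intro: mult_right_mono)
        finally have "(1 + x) powr p * exp (- (s * x)) \<le> C * exp (s / 2 * x) * exp (- (s * x))"
          by (rule mult_right_mono) simp
        also have "\<dots> = C * exp (- (s / 2 * x))"
          by (simp add: mult.assoc flip: exp_add)
        finally have "x powr \<alpha> * ((1 + x) powr p * exp (- (s * x))) \<le> x powr \<alpha> * (C * exp (- (s / 2 * x)))"
          by (rule mult_left_mono) simp
        with True show ?thesis
          by (simp add: kummer_fun_def abs_mult C_def mult_ac)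
      qed (simp add: kummer_fun_def)
    qed
  qed measurable
qed

lemma kummer_fun_mult_power:
  "x ^ n * kummer_fun \<alpha> p s x = kummer_fun (\<alpha> + real n) p s x"
  by (auto simp: kummer_fun_def indicator_def powr_add powr_realpow)

lemma kummer_fun_mult_one_plus:
  "(1 + x) * kummer_fun \<alpha> p s x = kummer_fun \<alpha> (p + 1) s x"
  by (auto simp: kummer_fun_def indicator_def powr_add)

lemma kummer_fun_mult_exp:
  "kummer_fun \<alpha> p s x * exp (- (t * x)) = kummer_fun \<alpha> p (s + t) x"
proof -
  have "exp (- ((s + t) * x)) = exp (- (s * x)) * exp (- (t * x))"
    by (simp add: algebra_simps flip: exp_add)
  then show ?thesis by (simp add: kummer_fun_def)
qed

text \<open>The derivative of \<open>x powr \<alpha> * (1 + x) powr p * exp (- s * x)\<close> integrates to \<open>0\<close> over \<open>(0, \<infinity>)\<close>.\<close>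
lemma kummer_fun_by_parts:
  assumes \<alpha>: "\<alpha> > 0" and s: "s > 0"
  shows "\<alpha> * (\<integral>x. kummer_fun (\<alpha> - 1) p s x \<partial>lborel) + p * (\<integral>x. kummer_fun \<alpha> (p - 1) s x \<partial>lborel)
    = s * (\<integral>x. kummer_fun \<alpha> p s x \<partial>lborel)"
proof -
  define q where "q x = x powr \<alpha> * (1 + x) powr p * exp (- (s * x))" for x :: real
  define q' where "q' x = \<alpha> * (x powr (\<alpha> - 1) * (1 + x) powr p * exp (- (s * x)))
      + p * (x powr \<alpha> * (1 + x) powr (p - 1) * exp (- (s * x)))
      - s * (x powr \<alpha> * (1 + x) powr p * exp (- (s * x)))" for x :: real
  have q'_eq: "indicator {0<..} x *\<^sub>R q' x = \<alpha> * kummer_fun (\<alpha> - 1) p s x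
      + p * kummer_fun \<alpha> (p - 1) s x - s * kummer_fun \<alpha> p s x" for x
    by (simp add: q'_def kummer_fun_def indicator_def)
  have ei: "einterval 0 \<infinity> = {0<..}"
    by (auto simp: einterval_def zero_ereal_def)
  \<comment> \<open>Both boundary terms vanish: at 0 because \<open>\<alpha> > 0\<close>, at
    infinity because \<open>s > 0\<close>.\<close>
  have "(LBINT x=0..\<infinity>. q' x) = 0 - 0"
  proof (rule interval_integral_FTC_integrable[where F = q])
    show "(q has_vector_derivative q' x) (at x)" if "0 < ereal x" for x
    proof -
      have x: "x > 0" "1 + x > 0" using that by (auto simp: zero_ereal_def)
      have d1: "((\<lambda>x. x powr \<alpha>) has_real_derivative \<alpha> * x powr (\<alpha> - 1)) (at x)"
        using x by (intro has_real_derivative_powr)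
      have d2: "((\<lambda>x. (1 + x) powr p) has_real_derivative p * (1 + x) powr (p - 1)) (at x)"
        using DERIV_fun_powr[of "\<lambda>x. 1 + x" 1 x p] x by (auto intro!: derivative_eq_intros)
      have d3: "((\<lambda>x. exp (- (s * x))) has_real_derivative - s * exp (- (s * x))) (at x)"
        by (auto intro!: derivative_eq_intros)
      note DERIV_mult[OF d1 DERIV_mult[OF d2 d3]]
      then have "(q has_real_derivative q' x) (at x)"
        unfolding q_def q'_def mult.assoc by (rule DERIV_cong) (simp add: algebra_simps)
      then show ?thesis
        by (simp add: has_real_derivative_iff_has_vector_derivative)
    qed
    show "isCont q' x" if "0 < ereal x" for x
      unfolding q'_def using that by (intro continuous_intros) (auto simp: zero_ereal_def)
    show "set_integrable lborel (einterval 0 \<infinity>) q'"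
      unfolding ei set_integrable_def q'_eq using \<alpha> s
      by (intro Bochner_Integration.integrable_add Bochner_Integration.integrable_diff
          integrable_mult_right integrable_kummer_fun) auto
    have "(q \<longlongrightarrow> q 0) (at_right 0)"
    proof -
      have "((\<lambda>x. x powr \<alpha>) \<longlongrightarrow> 0) (at_right 0)"
        using \<alpha> by real_asymp
      moreover have "((\<lambda>x. (1 + x) powr p * exp (- (s * x))) \<longlongrightarrow> (1 + 0) powr p * exp (- (s * 0))) (at_right (0::real))"
        by (intro tendsto_intros) auto
      ultimately have "((\<lambda>x. x powr \<alpha> * ((1 + x) powr p * exp (- (s * x)))) \<longlongrightarrow> 0 * ((1 + 0) powr p * exp (- (s * 0)))) (at_right (0::real))"
        by (rule tendsto_mult)
      then show ?thesis using \<alpha> by (simp add: q_def[abs_def] mult.assoc)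
    qed
    then show "((q \<circ> real_of_ereal) \<longlongrightarrow> 0) (at_right 0)"
      using \<alpha> by (simp add: zero_ereal_def ereal_tendsto_simps q_def)
    have "(q \<longlongrightarrow> 0) at_top"
      unfolding q_def using \<alpha> s by real_asymp
    then show "((q \<circ> real_of_ereal) \<longlongrightarrow> 0) (at_left \<infinity>)"
      by (simp add: ereal_tendsto_simps)
  qed auto
  also have "(LBINT x=0..\<infinity>. q' x) = (\<integral>x. \<alpha> * kummer_fun (\<alpha> - 1) p s x
      + p * kummer_fun \<alpha> (p - 1) s x - s * kummer_fun \<alpha> p s x \<partial>lborel)"
    by (simp only: interval_lebesgue_integral_def ei set_lebesgue_integral_def q'_eq) simp
  also have "\<dots> = \<alpha> * (\<integral>x. kummer_fun (\<alpha> - 1) p s x \<partial>lborel)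
      + p * (\<integral>x. kummer_fun \<alpha> (p - 1) s x \<partial>lborel) - s * (\<integral>x. kummer_fun \<alpha> p s x \<partial>lborel)"
    using \<alpha> s by (simp add: integrable_kummer_fun)
  finally show ?thesis by simp
qed

text \<open>If the integral were 0, the kernel would vanish almost everywhere, but it is positive on
  (0, 1).\<close>

lemma kummer_fun_integral_pos:
  assumes "\<alpha> > -1" "s > 0"
  shows "(\<integral>x. kummer_fun \<alpha> p s x \<partial>lborel) > 0"
proof -
  have "(\<integral>x. kummer_fun \<alpha> p s x \<partial>lborel) \<noteq> 0"
  proof
    assume "(\<integral>x. kummer_fun \<alpha> p s x \<partial>lborel) = 0"
    then have "AE x in lborel. kummer_fun \<alpha> p s x = 0"
      using integral_nonneg_eq_0_iff_AE[OF integrable_kummer_fun[OF assms, of p]] kummer_fun_nonneg by auto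
    then have "AE x in lborel. x \<notin> {0<..<1::real}"
      by eventually_elim (auto simp: kummer_fun_def)
    then have "emeasure lborel {0<..<1::real} = 0"
      by (subst (asm) AE_iff_measurable[OF _ refl]) (auto simp: greaterThanLessThan_def greaterThan_def lessThan_def Int_def)
    then show False by simp
  qed
  moreover have "(\<integral>x. kummer_fun \<alpha> p s x \<partial>lborel) \<ge> 0"
    by (simp add: kummer_fun_nonneg)
  ultimately show ?thesis by simp
qed

section \<open>Differential equations\<close>

lemma const_on_if_DERIV_zero:
  fixes f :: "real \<Rightarrow> real"
  assumes "\<And>s. s > 0 \<Longrightarrow> (f has_real_derivative 0) (at s)"
  shows "\<exists>C. \<forall>s>0. f s = C"
proof -
  have "(f has_derivative (\<lambda>h. 0)) (at s within {0<..})" if "s > 0" for s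
    using has_field_derivative_at_within[OF assms[OF that], of "{0<..}"]
    by (simp add: has_field_derivative_def lambda_zero)
  then show ?thesis
    using has_derivative_zero_constant[of "{0<..}" f] by auto
qed

text \<open>The hypothesis \<open>eq\<close> equates the logarithmic derivatives, so
  \<open>f / h\<close> has derivative 0.\<close>

lemma proportional_if_log_deriv_eq:
  fixes f h f' h' :: "real \<Rightarrow> real"
  assumes f: "\<And>s. s > 0 \<Longrightarrow> (f has_real_derivative f' s) (at s)"
    and h: "\<And>s. s > 0 \<Longrightarrow> (h has_real_derivative h' s) (at s)"
    and pos: "\<And>s. s > 0 \<Longrightarrow> f s > 0" "\<And>s. s > 0 \<Longrightarrow> h s > 0"
    and eq: "\<And>s. s > 0 \<Longrightarrow> f' s * h s = f s * h' s"
  obtains K where "K > 0" "\<And>s. s > 0 \<Longrightarrow> f s = K * h s"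
proof -
  have "((\<lambda>s. f s / h s) has_real_derivative 0) (at s)" if "s > 0" for s
    by (rule DERIV_cong[OF DERIV_divide[OF f h]]) (use that pos(2)[OF that] eq in auto)
  then obtain K where K: "\<And>s. s > 0 \<Longrightarrow> f s / h s = K"
    using const_on_if_DERIV_zero[of "\<lambda>s. f s / h s"] by auto
  show thesis
  proof
    show "K > 0" using K[of 1] pos[of 1] by (metis divide_pos_pos zero_less_one)
    show "f s = K * h s" if "s > 0" for s
      using K[OF that] pos(2)[OF that] by (auto simp: field_simps)
  qed
qed

lemma mono_if_DERIV_nonneg:
  fixes f f' :: "real \<Rightarrow> real"
  assumes "\<And>s. s > 0 \<Longrightarrow> (f has_real_derivative f' s) (at s)" "\<And>s. s > 0 \<Longrightarrow> f' s \<ge> 0"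
    and "0 < s" "s \<le> t"
  shows "f s \<le> f t"
proof (rule DERIV_nonneg_imp_nondecreasing[OF \<open>s \<le> t\<close>])
  fix x assume "s \<le> x"
  then have "x > 0" using \<open>0 < s\<close> by simp
  then show "\<exists>y. (f has_real_derivative y) (at x) \<and> 0 \<le> y"
    using assms(1,2) by blast
qed

text \<open>Both triples \<open>(f1, - f2, f3)\<close> and \<open>(h1, - h2, h3)\<close> consist of a solution of
  \<open>g y + y' + \<kappa> (s + c) (y' - y'') = 0\<close> and its derivatives. The Wronskian of the two solutions grows at
  least like \<open>exp (s / 2)\<close> unless it vanishes, whereas the monotonicity of the solutions bounds it.\<close>
lemma proportional_if_second_order_ode:
  fixes f1 f2 f3 h1 h2 h3 :: "real \<Rightarrow> real" and g \<kappa> c :: real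
  assumes df1: "\<And>s. s > 0 \<Longrightarrow> (f1 has_real_derivative - f2 s) (at s)"
    and df2: "\<And>s. s > 0 \<Longrightarrow> (f2 has_real_derivative - f3 s) (at s)"
    and dh1: "\<And>s. s > 0 \<Longrightarrow> (h1 has_real_derivative - h2 s) (at s)"
    and dh2: "\<And>s. s > 0 \<Longrightarrow> (h2 has_real_derivative - h3 s) (at s)"
    and f_pos: "\<And>s. s > 0 \<Longrightarrow> f1 s > 0" "\<And>s. s > 0 \<Longrightarrow> f2 s \<ge> 0" "\<And>s. s > 0 \<Longrightarrow> f3 s \<ge> 0"
    and h_pos: "\<And>s. s > 0 \<Longrightarrow> h1 s > 0" "\<And>s. s > 0 \<Longrightarrow> h2 s \<ge> 0" "\<And>s. s > 0 \<Longrightarrow> h3 s \<ge> 0"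
    and \<kappa>: "\<kappa> > 0" "c > 0"
    and f_ode: "\<And>s. s > 0 \<Longrightarrow> g * f1 s - f2 s = \<kappa> * (s + c) * (f2 s + f3 s)"
    and h_ode: "\<And>s. s > 0 \<Longrightarrow> g * h1 s - h2 s = \<kappa> * (s + c) * (h2 s + h3 s)"
  obtains K where "K > 0" "\<And>s. s > 0 \<Longrightarrow> f1 s = K * h1 s"
proof -
  define W where "W s = f1 s * h2 s - f2 s * h1 s" for s
  define r where "r s = 1 / (\<kappa> * (s + c))" for s
  have r: "r s > 0" if "s > 0" for s using that \<kappa> by (simp add: r_def)
  \<comment> \<open>Abel's identity: solved for \<open>f3\<close> and \<open>h3\<close>, the two
    equations have the same coefficients, so the terms with \<open>g\<close> cancel and a linear
    first order equation for the Wronskian remains.\<close>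
  have dW: "(W has_real_derivative (1 + r s) * W s) (at s)" if s: "s > 0" for s
  proof -
    have "r s * (\<kappa> * (s + c)) = 1" using s \<kappa> by (simp add: r_def)
    then have f3: "f3 s = r s * (g * f1 s - f2 s) - f2 s" and h3: "h3 s = r s * (g * h1 s - h2 s) - h2 s"
      unfolding f_ode[OF s] h_ode[OF s] by (simp_all add: mult.assoc[symmetric])
    have "- f2 s * h2 s + - h3 s * f1 s - (- f3 s * h1 s + - h2 s * f2 s) = (1 + r s) * W s"
      unfolding W_def f3 h3 by (simp add: algebra_simps)
    then show ?thesis
      using DERIV_diff[OF DERIV_mult[OF df1 dh2] DERIV_mult[OF df2 dh1], OF s s s s]
      unfolding W_def by simp
  qed
  have W0: "W s = 0" if s: "s > 0" for s
  proof -
    \<comment> \<open>Squaring removes the unknown sign of \<open>W\<close>. The square grows at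
      rate \<open>2 * (1 + r)\<close>, so it remains nondecreasing after multiplication by
      \<open>exp (- s)\<close>.\<close>
    have mono_W: "(W s)\<^sup>2 * exp (- s) \<le> (W t)\<^sup>2 * exp (- t)" if "s \<le> t" for t
    proof (rule mono_if_DERIV_nonneg[OF _ _ s that])
      fix u :: real assume u: "u > 0"
      show "((\<lambda>u. (W u)\<^sup>2 * exp (- u)) has_real_derivative (W u)\<^sup>2 * exp (- u) * (1 + 2 * r u)) (at u)"
        by (auto intro!: derivative_eq_intros dW u simp: algebra_simps power2_eq_square)
      show "(W u)\<^sup>2 * exp (- u) * (1 + 2 * r u) \<ge> 0"
        using r[OF u] by simp
    qed
    have decr: "f1 t \<le> f1 s" "f2 t \<le> f2 s" "h1 t \<le> h1 s" "h2 t \<le> h2 s" if "s \<le> t" for t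
    proof -
      have *: "f t \<le> f s" if "\<And>s. s > 0 \<Longrightarrow> (f has_real_derivative - f' s) (at s)"
          "\<And>s. s > 0 \<Longrightarrow> f' s \<ge> 0" for f f'
        using mono_if_DERIV_nonneg[of "\<lambda>s. - f s" f' s t] s \<open>s \<le> t\<close> that
          DERIV_minus[OF that(1)] by simp
      show "f1 t \<le> f1 s" "f2 t \<le> f2 s" "h1 t \<le> h1 s" "h2 t \<le> h2 s"
        using *[OF df1] *[OF df2] *[OF dh1] *[OF dh2] f_pos h_pos by auto
    qed
    define B where "B = f1 s * h2 s + f2 s * h1 s"
    have W_le: "(W t)\<^sup>2 \<le> B\<^sup>2" if t: "s \<le> t" for t
    proof -
      have t0: "t > 0" using s t by simp
      have "0 \<le> f1 t * h2 t" "0 \<le> f2 t * h1 t"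
        using f_pos[OF t0] h_pos[OF t0] by simp_all
      moreover have "f1 t * h2 t \<le> f1 s * h2 s" "f2 t * h1 t \<le> f2 s * h1 s"
        using decr[OF t] f_pos[OF t0] h_pos[OF t0] f_pos[OF s] h_pos[OF s]
        by (intro mult_mono; simp)+
      ultimately have "\<bar>W t\<bar> \<le> \<bar>B\<bar>" unfolding W_def B_def by linarith
      then show ?thesis by (simp add: abs_le_square_iff)
    qed
    \<comment> \<open>As \<open>t\<close> tends to infinity, the bounded
      \<open>(W t)\<^sup>2\<close> is beaten by \<open>exp (- t)\<close>, so the nondecreasing
      quantity is at most 0 already at \<open>s\<close>.\<close>
    have "((\<lambda>t. B\<^sup>2 * exp (- t)) \<longlongrightarrow> B\<^sup>2 * 0) at_top"
      by (intro tendsto_mult tendsto_const filterlim_compose[OF exp_at_bot] filterlim_uminus_at_bot_at_top)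
    moreover have "eventually (\<lambda>t. (W s)\<^sup>2 * exp (- s) \<le> B\<^sup>2 * exp (- t)) at_top"
      using eventually_ge_at_top[of s]
    proof eventually_elim
      case (elim t)
      show ?case
        using mono_W[OF elim] mult_right_mono[OF W_le[OF elim], of "exp (- t)"] by (rule order_trans) simp
    qed
    ultimately have "(W s)\<^sup>2 * exp (- s) \<le> B\<^sup>2 * 0"
      by (rule tendsto_lowerbound) simp
    moreover have "(W s)\<^sup>2 * exp (- s) \<ge> 0" by simp
    ultimately have "(W s)\<^sup>2 * exp (- s) = 0" by linarith
    then show ?thesis by simp
  qed
  show thesis
  proof (rule proportional_if_log_deriv_eq[OF df1 dh1 f_pos(1) h_pos(1)])
    show "- f2 s * h1 s = f1 s * - h2 s" if "s > 0" for s
      using W0[OF that] by (simp add: W_def algebra_simps)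
  qed (use that in auto)
qed

text \<open>The locale collects what the independence of \<open>U\<close> and \<open>V\<close> says about the Laplace transforms:
  \<open>F\<close>, \<open>R\<close>, \<open>R2\<close> are those of \<open>Y\<close> with weights \<open>1\<close>, \<open>Y\<close>, \<open>Y\<^sup>2\<close>, while \<open>P j\<close> and \<open>Q j\<close> are
  those of \<open>X\<close> and \<open>V\<close> with weights \<open>X ^ j / (1 + X)\<^sup>2\<close> and \<open>V ^ j / (1 + V)\<^sup>2\<close>; \<open>c1\<close> and \<open>c2\<close> are
  the first two moments of \<open>U\<close>.\<close>
locale laplace_system =
  fixes P Q :: "nat \<Rightarrow> real \<Rightarrow> real" and F R R2 :: "real \<Rightarrow> real" and c1 c2 :: real
  assumes dP: "\<And>j s. s > 0 \<Longrightarrow> (P j has_real_derivative - P (Suc j) s) (at s)"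
    and dQ: "\<And>j s. s > 0 \<Longrightarrow> (Q j has_real_derivative - Q (Suc j) s) (at s)"
    and dF: "\<And>s. s > 0 \<Longrightarrow> (F has_real_derivative - R s) (at s)"
    and dR: "\<And>s. s > 0 \<Longrightarrow> (R has_real_derivative - R2 s) (at s)"
    and P_pos: "\<And>j s. s > 0 \<Longrightarrow> P j s > 0"
    and Q_pos: "\<And>j s. s > 0 \<Longrightarrow> Q j s > 0"
    and F_pos: "\<And>s. s > 0 \<Longrightarrow> F s > 0"
    and R_pos: "\<And>s. s > 0 \<Longrightarrow> R s > 0"
    and F_le_1: "\<And>s. s > 0 \<Longrightarrow> F s \<le> 1"
    and R2_gt: "\<And>s. s > 0 \<Longrightarrow> (R s)\<^sup>2 < F s * R2 s"
    and c: "0 < c2" "c2 < c1" "c1 < 1"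
    and FP0: "\<And>s. s > 0 \<Longrightarrow> F s * P 0 s = Q 0 s + 2 * (1 - c1) * Q 1 s + (1 - 2 * c1 + c2) * Q 2 s"
    and FP1: "\<And>s. s > 0 \<Longrightarrow> F s * P 1 s = c1 * Q 1 s + (c1 - c2) * Q 2 s"
    and FP2: "\<And>s. s > 0 \<Longrightarrow> F s * P 2 s = c2 * Q 2 s"
begin

text \<open>In terms of \<open>U\<close>, these are \<open>d = E (1 - U)\<close>, \<open>e = E (U (1 - U))\<close> and \<open>\<kappa> = Var U / (d e)\<close>.\<close>
definition "d = 1 - c1"
definition "e = c1 - c2"
definition "\<kappa> = c1 / e - 1 / d"

lemma d_pos: "d > 0" and e_pos: "e > 0"
  using c by (auto simp: d_def e_def)

lemma dFP: "s > 0 \<Longrightarrow> ((\<lambda>s. F s * P j s) has_real_derivative - R s * P j s - F s * P (Suc j) s) (at s)"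
  by (rule DERIV_cong[OF DERIV_mult[OF dF dP]]) auto

text \<open>Differentiating \<open>FP1\<close> gives \<open>R P1 + F P2 = c1 Q2 + e Q3\<close>;
  after multiplication by \<open>F\<close>, the relations \<open>FP1\<close> and \<open>FP2\<close>
  remove both transforms of \<open>X\<close>.\<close>

lemma ode1:
  assumes s: "s > 0"
  shows "R s * (c1 * Q 1 s + e * Q 2 s) = e * F s * (Q 2 s + Q 3 s)"
proof -
  have "((\<lambda>s. F s * P 1 s) has_real_derivative - c1 * Q 2 s - e * Q 3 s) (at s)"
  proof (rule DERIV_cong[OF has_field_derivative_transform_within_open[where S = "{0<..}"]])
    show "((\<lambda>s. c1 * Q 1 s + e * Q 2 s) has_real_derivative c1 * - Q (Suc 1) s + e * - Q (Suc 2) s) (at s)"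
      by (intro DERIV_add DERIV_cmult dQ s)
  qed (use s FP1 in \<open>auto simp: e_def eval_nat_numeral\<close>)
  from DERIV_unique[OF this dFP[OF s]]
  have eq: "R s * P 1 s + F s * P 2 s = c1 * Q 2 s + e * Q 3 s"
    by (simp add: numeral_2_eq_2)
  have "R s * (F s * P 1 s) + F s * (F s * P 2 s) = F s * (R s * P 1 s + F s * P 2 s)"
    by (simp only: distrib_left mult_ac)
  also note eq
  finally have "R s * (F s * P 1 s) + F s * (F s * P 2 s) = F s * (c1 * Q 2 s + e * Q 3 s)" .
  then show ?thesis
    unfolding FP1[OF s] FP2[OF s] e_def by (simp add: algebra_simps)
qed

text \<open>The same elimination starting from the derivative of \<open>FP0\<close>; the coefficient
  \<open>1 - 2 * c1 + c2\<close> is \<open>d - e\<close>.\<close>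

lemma ode0:
  assumes s: "s > 0"
  shows "R s * (Q 0 s + 2 * d * Q 1 s + (d - e) * Q 2 s)
    = F s * (d * Q 1 s + (2 * d - e) * Q 2 s + (d - e) * Q 3 s)"
proof -
  have "((\<lambda>s. F s * P 0 s) has_real_derivative - Q 1 s - 2 * d * Q 2 s - (d - e) * Q 3 s) (at s)"
  proof (rule DERIV_cong[OF has_field_derivative_transform_within_open[where S = "{0<..}"]])
    show "((\<lambda>s. Q 0 s + 2 * d * Q 1 s + (d - e) * Q 2 s) has_real_derivative
        - Q (Suc 0) s + 2 * d * - Q (Suc 1) s + (d - e) * - Q (Suc 2) s) (at s)"
      by (intro DERIV_add DERIV_cmult dQ s)
  qed (use s FP0 in \<open>auto simp: d_def e_def eval_nat_numeral algebra_simps\<close>)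
  from DERIV_unique[OF this dFP[OF s]]
  have eq: "R s * P 0 s + F s * P 1 s = Q 1 s + 2 * d * Q 2 s + (d - e) * Q 3 s"
    by simp
  have "R s * (F s * P 0 s) + F s * (F s * P 1 s) = F s * (R s * P 0 s + F s * P 1 s)"
    by (simp only: distrib_left mult_ac)
  also note eq
  finally have "R s * (F s * P 0 s) + F s * (F s * P 1 s) = F s * (Q 1 s + 2 * d * Q 2 s + (d - e) * Q 3 s)" .
  then show ?thesis
    unfolding FP0[OF s] FP1[OF s] d_def e_def by (simp add: algebra_simps)
qed

text \<open>Eliminating \<open>Q 3\<close> between the last two equations happens to eliminate \<open>Q 2\<close> from the left-hand
  side as well; this is what makes the system collapse to a Riccati equation for \<open>R / F\<close>.\<close>
lemma riccati:
  assumes s: "s > 0"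
  shows "F s * R2 s = (1 + \<kappa>) * (R s)\<^sup>2"
proof -
  \<comment> \<open>The coefficient of \<open>Q 1\<close> on the left of the combination
    \<open>e\<close> times \<open>ode0\<close> minus \<open>d - e\<close> times \<open>ode1\<close>,
    after division by \<open>e\<close>.\<close>
  define k where "k = 2 * d - (d - e) * c1 / e"
  have eq: "R s * (Q 0 s + k * Q 1 s) = d * F s * (Q 1 s + Q 2 s)" if s: "s > 0" for s
  proof -
    have "e * (R s * (Q 0 s + 2 * d * Q 1 s + (d - e) * Q 2 s)) - (d - e) * (R s * (c1 * Q 1 s + e * Q 2 s))
       = e * (F s * (d * Q 1 s + (2 * d - e) * Q 2 s + (d - e) * Q 3 s)) - (d - e) * (e * F s * (Q 2 s + Q 3 s))"
      by (simp only: ode0[OF s] ode1[OF s])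
    then have "e * (R s * (Q 0 s + k * Q 1 s)) = e * (d * F s * (Q 1 s + Q 2 s))"
      using e_pos by (simp add: k_def field_simps)
    then show ?thesis using e_pos by simp
  qed
  have k: "k - d = 1 - d * c1 / e"
    using e_pos unfolding k_def d_def by (simp add: field_simps)
  have "((\<lambda>s. R s * (Q 0 s + k * Q 1 s)) has_real_derivative
      - R2 s * (Q 0 s + k * Q 1 s) - R s * (Q 1 s + k * Q 2 s)) (at s)"
    by (rule DERIV_cong[OF DERIV_mult[OF dR DERIV_add[OF dQ DERIV_cmult[OF dQ]]]])
       (use s in \<open>simp_all add: eval_nat_numeral algebra_simps\<close>)
  moreover have "((\<lambda>s. R s * (Q 0 s + k * Q 1 s)) has_real_derivative
      - d * R s * (Q 1 s + Q 2 s) - d * F s * (Q 2 s + Q 3 s)) (at s)"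
  proof (rule DERIV_cong[OF has_field_derivative_transform_within_open[where S = "{0<..}"]])
    show "((\<lambda>s. d * (F s * (Q 1 s + Q 2 s))) has_real_derivative
        d * (- R s * (Q 1 s + Q 2 s) + (- Q (Suc 1) s + - Q (Suc 2) s) * F s)) (at s)"
      by (intro DERIV_add DERIV_cmult DERIV_mult dF dQ s)
  qed (use s eq in \<open>auto simp: eval_nat_numeral algebra_simps\<close>)
  ultimately have D: "R2 s * (Q 0 s + k * Q 1 s) + R s * (Q 1 s + k * Q 2 s)
      = d * R s * (Q 1 s + Q 2 s) + d * F s * (Q 2 s + Q 3 s)"
    using DERIV_unique by fastforce
  define A where "A = Q 0 s + k * Q 1 s"
  have A: "R s * A = d * F s * (Q 1 s + Q 2 s)" using eq[OF s] by (simp add: A_def)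
  have "d * F s * (Q 1 s + Q 2 s) > 0"
    using d_pos F_pos[OF s] Q_pos[OF s] by (simp add: add_pos_pos)
  then have A0: "A \<noteq> 0" using A by auto
  \<comment> \<open>\<open>ode1\<close> is used once more, now to remove \<open>Q 3\<close> from the
    differentiated relation \<open>D\<close>.\<close>
  have Q23: "F s * (Q 2 s + Q 3 s) = R s * (c1 / e * Q 1 s + Q 2 s)"
    using ode1[OF s] e_pos by (simp add: field_simps)
  have "R2 s * A = d * R s * (Q 1 s + Q 2 s) + d * (R s * (c1 / e * Q 1 s + Q 2 s)) - R s * (Q 1 s + k * Q 2 s)"
    using D unfolding A_def Q23[symmetric] by (simp add: algebra_simps)
  also have "\<dots> = R s * ((d - 1 + d * c1 / e) * Q 1 s + (2 * d - k) * Q 2 s)"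
    by (simp add: algebra_simps)
  \<comment> \<open>The coefficients of \<open>Q 1\<close> and \<open>Q 2\<close> coincide, so the
    right-hand side is a multiple of \<open>Q 1 + Q 2\<close>, which the relation for
    \<open>A\<close> turns back into \<open>R s * A\<close>. The factor \<open>A\<close> then
    cancels.\<close>
  also have "2 * d - k = d - 1 + d * c1 / e" using k by simp
  also have "d - 1 + d * c1 / e = d * (1 + \<kappa>)"
    using d_pos by (simp add: \<kappa>_def field_simps)
  finally have "R2 s * A = R s * (d * (1 + \<kappa>) * Q 1 s + d * (1 + \<kappa>) * Q 2 s)" .
  then have "F s * R2 s * A = F s * (R s * (d * (1 + \<kappa>) * Q 1 s + d * (1 + \<kappa>) * Q 2 s))"
    by (simp only: mult.assoc)
  also have "\<dots> = (1 + \<kappa>) * R s * (d * F s * (Q 1 s + Q 2 s))"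
    by (simp add: algebra_simps)
  also have "\<dots> = (1 + \<kappa>) * (R s)\<^sup>2 * A"
    unfolding A[symmetric] by (simp add: power2_eq_square)
  finally show ?thesis using A0 by simp
qed

text \<open>The Riccati equation is compared at one point with the strict Cauchy-Schwarz inequality
  \<open>R2_gt\<close>, which reflects the non-degeneracy of \<open>Y\<close>.\<close>

lemma \<kappa>_pos: "\<kappa> > 0"
proof -
  have "(R 1)\<^sup>2 < (1 + \<kappa>) * (R 1)\<^sup>2"
    using riccati[of 1] R2_gt[of 1] by simp
  then have "\<kappa> * (R 1)\<^sup>2 > 0" by (simp add: algebra_simps)
  then show ?thesis by (simp add: zero_less_mult_iff)
qed

text \<open>This number becomes the parameter \<open>a\<close> of the Kummer law. It is positive
  because \<open>c2 / e - \<kappa> = c1 / d\<close>.\<close>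

lemma shape_pos: "c2 / e / \<kappa> - 1 > 0"
proof -
  have "d * e * (c2 / e - \<kappa>) = c1 * e"
    using d_pos e_pos by (simp add: \<kappa>_def field_simps) (simp add: d_def e_def algebra_simps)
  moreover have "c1 * e > 0" using c e_pos by simp
  ultimately have "c2 / e - \<kappa> > 0"
    using d_pos e_pos by (metis zero_less_mult_pos mult_pos_pos)
  then have "\<kappa> / \<kappa> < c2 / e / \<kappa>"
    using \<kappa>_pos by (intro divide_strict_right_mono) auto
  then show ?thesis using \<kappa>_pos by simp
qed

text \<open>By the Riccati equation \<open>F / R\<close> has derivative \<kappa>, so
  \<open>F / R = \<kappa> * s + \<theta>\<close>. Letting \<open>s\<close> tend to 0 gives
  \<open>\<theta> \<ge> 0\<close>; the bound \<open>F \<le> 1\<close> excludes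
  \<open>\<theta> = 0\<close>.\<close>

lemma F_over_R:
  obtains c where "c > 0" "\<And>s. s > 0 \<Longrightarrow> F s = \<kappa> * (s + c) * R s"
proof -
  have "((\<lambda>s. F s / R s - \<kappa> * s) has_real_derivative 0) (at s)" if s: "s > 0" for s
  proof -
    have "(- R s * R s - F s * - R2 s) / (R s * R s) - \<kappa> * 1 = 0"
      using riccati[OF s] R_pos[OF s] by (simp add: field_simps power2_eq_square)
    then show ?thesis
      using DERIV_diff[OF DERIV_divide[OF dF[OF s] dR[OF s]] DERIV_cmult[OF DERIV_ident, of \<kappa>]] R_pos[OF s]
      by simp
  qed
  then obtain \<theta> where \<theta>: "\<And>s. s > 0 \<Longrightarrow> F s / R s - \<kappa> * s = \<theta>"
    using const_on_if_DERIV_zero[of "\<lambda>s. F s / R s - \<kappa> * s"] by auto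
  have F_eq: "F s = (\<kappa> * s + \<theta>) * R s" if "s > 0" for s
    using \<theta>[OF that] R_pos[OF that] by (simp add: field_simps)
  have pos: "\<kappa> * s + \<theta> > 0" if "s > 0" for s
    using F_eq[OF that] F_pos[OF that] R_pos[OF that] by (metis zero_less_mult_pos2)
  have "\<theta> > 0"
  proof (rule ccontr)
    assume neg: "\<not> \<theta> > 0"
    have "((\<lambda>s. \<kappa> * s + \<theta>) \<longlongrightarrow> \<kappa> * 0 + \<theta>) (at_right 0)"
      by (intro tendsto_intros)
    then have "\<kappa> * 0 + \<theta> \<ge> 0"
      by (rule tendsto_lowerbound)
         (auto simp: eventually_at_right_field intro!: exI[of _ 1] less_imp_le pos)
    with neg have "\<theta> = 0" by simp
    then have R_eq: "R s * s = F s / \<kappa>" if "s > 0" for s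
      using F_eq[OF that] \<kappa>_pos by (simp add: field_simps)
    define p where "p = 1 / \<kappa>"
    have p: "p > 0" using \<kappa>_pos by (simp add: p_def)
    \<comment> \<open>For \<open>\<theta> = 0\<close> the function \<open>F\<close> would be a
      multiple of \<open>s powr (- p)\<close>, which is unbounded near 0.\<close>
    have "((\<lambda>s. F s * s powr p) has_real_derivative 0) (at s)" if s: "s > 0" for s
    proof (rule DERIV_cong[OF DERIV_mult[OF dF[OF s] has_real_derivative_powr[OF s]]])
      have "s powr p = s * s powr (p - 1)" using s by (simp add: powr_diff)
      then have "- R s * s powr p + p * s powr (p - 1) * F s = s powr (p - 1) * (p * F s - R s * s)"
        by (simp add: algebra_simps)
      then show "- R s * s powr p + p * s powr (p - 1) * F s = 0"
        using R_eq[OF s] by (simp add: p_def)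
    qed
    then obtain C where C: "\<And>s. s > 0 \<Longrightarrow> F s * s powr p = C"
      using const_on_if_DERIV_zero[of "\<lambda>s. F s * s powr p"] by auto
    have C_pos: "C > 0" using C[of 1] F_pos[of 1] by simp
    \<comment> \<open>At this point \<open>F t\<close> would equal 2.\<close>
    define t where "t = (C / 2) powr (1 / p)"
    have "t > 0" using C_pos by (simp add: t_def)
    moreover have "t powr p = C / 2"
      using C_pos p by (simp add: t_def powr_powr)
    ultimately have "F t * (C / 2) = C" "F t * (C / 2) \<le> 1 * (C / 2)"
      using C[of t] F_le_1[of t] C_pos by (simp_all only:) (auto intro: mult_right_mono)
    then show False using C_pos by linarith
  qed
  show thesis
  proof
    show "\<theta> / \<kappa> > 0" using \<open>\<theta> > 0\<close> \<kappa>_pos by simp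
    show "F s = \<kappa> * (s + \<theta> / \<kappa>) * R s" if "s > 0" for s
      using F_eq[OF that] \<kappa>_pos by (simp add: field_simps)
  qed
qed

text \<open>This is \<open>ode1\<close> freed of \<open>Q\<close>: \<open>FP1\<close> rewrites its
  left side, \<open>FP2\<close> gives \<open>Q 2\<close> and the derivative of \<open>FP2\<close>
  gives \<open>Q 3\<close>. Inserting the affine form of \<open>F / R\<close> turns it into a second
  order equation for \<open>P 1\<close>.\<close>

lemma ode_P:
  assumes s: "s > 0"
  shows "R s * (c2 / e * P 1 s - P 2 s) = F s * (P 2 s + P 3 s)"
proof -
  have "((\<lambda>s. F s * P 2 s) has_real_derivative - c2 * Q 3 s) (at s)"
  proof (rule DERIV_cong[OF has_field_derivative_transform_within_open[where S = "{0<..}"]])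
    show "((\<lambda>s. c2 * Q 2 s) has_real_derivative c2 * - Q (Suc 2) s) (at s)"
      by (intro DERIV_cmult dQ s)
  qed (use s FP2 in \<open>auto simp: eval_nat_numeral\<close>)
  from DERIV_unique[OF this dFP[OF s]]
  have Q3: "c2 * Q 3 s = R s * P 2 s + F s * P 3 s"
    by (simp add: eval_nat_numeral)
  have "F s * (c2 * (R s * P 1 s)) = R s * c2 * (F s * P 1 s)"
    by (simp only: mult_ac)
  also have "\<dots> = R s * c2 * (c1 * Q 1 s + e * Q 2 s)"
    by (simp only: FP1[OF s] e_def)
  also have "\<dots> = c2 * (R s * (c1 * Q 1 s + e * Q 2 s))"
    by (simp only: mult_ac)
  also have "\<dots> = e * F s * (c2 * Q 2 s + c2 * Q 3 s)"
    unfolding ode1[OF s] by (simp add: algebra_simps)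
  also have "\<dots> = F s * (e * (F s * P 2 s + R s * P 2 s + F s * P 3 s))"
    unfolding Q3 FP2[OF s, symmetric] by (simp add: algebra_simps)
  finally have "c2 * (R s * P 1 s) = e * (F s * P 2 s + R s * P 2 s + F s * P 3 s)"
    using F_pos[OF s] by simp
  then show ?thesis
    using e_pos by (simp add: field_simps)
qed

end

section \<open>Independence\<close>

definition kummer_integral :: "real \<Rightarrow> real \<Rightarrow> real \<Rightarrow> real" where
  "kummer_integral \<alpha> p s = (\<integral>x. kummer_fun \<alpha> p s x \<partial>lborel)"

lemma DERIV_kummer_integral:
  assumes \<alpha>: "\<alpha> > -1" and s: "s > 0"
  shows "(kummer_integral \<alpha> p has_real_derivative - kummer_integral (\<alpha> + 1) p s) (at s)"
proof -
  \<comment> \<open>\<open>DERIV_laplace\<close> asks for a nonnegative variable, while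
    \<open>lborel\<close> charges the negative half-line; \<open>max 0 x\<close> agrees with
    \<open>x\<close> wherever the kernel is nonzero.\<close>
  have eq: "kummer_fun \<alpha> p 0 x * exp (- (t * max 0 x)) = kummer_fun \<alpha> p t x" for t x
    using kummer_fun_mult_exp[of \<alpha> p 0 x t] by (cases "x > 0") (auto simp: kummer_fun_def)
  have eq': "max 0 x * kummer_fun \<alpha> p 0 x * exp (- (t * max 0 x)) = kummer_fun (\<alpha> + 1) p t x" for t x
    using eq[of x t] kummer_fun_mult_power[of x 1 \<alpha> p t]
    by (cases "x > 0") (auto simp: kummer_fun_def mult_ac)
  have "((\<lambda>t. \<integral>x. kummer_fun \<alpha> p 0 x * exp (- (t * max 0 x)) \<partial>lborel) has_real_derivative
      - (\<integral>x. max 0 x * kummer_fun \<alpha> p 0 x * exp (- (s * max 0 x)) \<partial>lborel)) (at s)"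
    by (rule DERIV_laplace) (use \<alpha> s in \<open>auto simp: eq integrable_kummer_fun\<close>)
  then show ?thesis
    unfolding eq eq' kummer_integral_def[abs_def] .
qed

lemma kummer_integral_mult_one_plus:
  assumes "\<alpha> > -1" "s > 0"
  shows "kummer_integral \<alpha> (p + 1) s = kummer_integral \<alpha> p s + kummer_integral (\<alpha> + 1) p s"
proof -
  have "kummer_fun \<alpha> (p + 1) s = (\<lambda>x. kummer_fun \<alpha> p s x + kummer_fun (\<alpha> + 1) p s x)"
  proof
    show "kummer_fun \<alpha> (p + 1) s x = kummer_fun \<alpha> p s x + kummer_fun (\<alpha> + 1) p s x" for x
      using kummer_fun_mult_one_plus[of x \<alpha> p s] kummer_fun_mult_power[of x 1 \<alpha> p s]
      by (simp add: distrib_right)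
  qed
  then show ?thesis
    unfolding kummer_integral_def using assms by (simp add: integrable_kummer_fun)
qed

lemma gamma_kernel_eq_kummer_fun: "gamma_kernel b c = kummer_fun (b - 1) 0 c"
  by (auto simp: gamma_kernel_def kummer_fun_def fun_eq_iff indicator_def)

lemma kummer_kernel_eq_kummer_fun: "kummer_kernel a b c = kummer_fun (a - 1) (- (a + b)) c"
  by (auto simp: kummer_kernel_def kummer_fun_def fun_eq_iff indicator_def powr_minus_divide
      simp del: minus_add_distrib)

section \<open>Weighted Laplace transforms of positive random variables\<close>

lemma (in prob_space) expectation_pos:
  fixes f :: "'a \<Rightarrow> real"
  assumes "integrable M f" "AE \<omega> in M. f \<omega> > 0"
  shows "expectation f > 0"
  using integral_less_AE_space[of "\<lambda>_. 0" f] assms emeasure_space_1 by simp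

lemma (in prob_space) indep_var_expectation_mult:
  fixes X Y :: "'a \<Rightarrow> real" and f g :: "real \<Rightarrow> real"
  assumes ind: "indep_var borel X borel Y"
    and [measurable]: "f \<in> borel_measurable borel" "g \<in> borel_measurable borel"
    and int: "integrable M (\<lambda>\<omega>. f (X \<omega>))" "integrable M (\<lambda>\<omega>. g (Y \<omega>))"
  shows "expectation (\<lambda>\<omega>. f (X \<omega>) * g (Y \<omega>)) = expectation (\<lambda>\<omega>. f (X \<omega>)) * expectation (\<lambda>\<omega>. g (Y \<omega>))"
    and "integrable M (\<lambda>\<omega>. f (X \<omega>) * g (Y \<omega>))"
proof -
  have "indep_var borel (\<lambda>\<omega>. f (X \<omega>)) borel (\<lambda>\<omega>. g (Y \<omega>))"
    using indep_var_compose[OF ind, of f borel g borel] by (simp add: comp_def)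
  from indep_var_lebesgue_integral[OF this int] indep_var_integrable[OF this int]
  show "expectation (\<lambda>\<omega>. f (X \<omega>) * g (Y \<omega>)) = expectation (\<lambda>\<omega>. f (X \<omega>)) * expectation (\<lambda>\<omega>. g (Y \<omega>))"
    "integrable M (\<lambda>\<omega>. f (X \<omega>) * g (Y \<omega>))" .
qed

text \<open>Keeping the power apart from the weight makes differentiation in \<open>s\<close> raise
  \<open>j\<close> by one, up to sign.\<close>

definition wlaplace :: "'a measure \<Rightarrow> (real \<Rightarrow> real) \<Rightarrow> ('a \<Rightarrow> real) \<Rightarrow> nat \<Rightarrow> real \<Rightarrow> real" where
  "wlaplace M w Z j s = (\<integral>\<omega>. Z \<omega> ^ j * w (Z \<omega>) * exp (- (s * Z \<omega>)) \<partial>M)"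

context prob_space
begin

context
  fixes Z :: "'a \<Rightarrow> real" and w :: "real \<Rightarrow> real"
  assumes Z[measurable]: "random_variable borel Z" and Z_pos: "AE \<omega> in M. Z \<omega> > 0"
    and w[measurable]: "w \<in> borel_measurable borel" and w_pos: "\<And>z. z > 0 \<Longrightarrow> w z > 0"
    and w_le: "\<And>z. z > 0 \<Longrightarrow> w z \<le> 1"
begin

text \<open>Induction on \<open>j\<close> from a bounded integrand; \<open>s\<close> stays arbitrary
  because each step draws on a smaller rate.\<close>

lemma integrable_wlaplace:
  assumes "s > 0"
  shows "integrable M (\<lambda>\<omega>. Z \<omega> ^ j * w (Z \<omega>) * exp (- (s * Z \<omega>)))"
  using assms
proof (induction j arbitrary: s)
  case 0
  show ?case
  proof (rule integrable_const_bound[where B = 1])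
    show "AE \<omega> in M. norm (Z \<omega> ^ 0 * w (Z \<omega>) * exp (- (s * Z \<omega>))) \<le> 1"
      using Z_pos
    proof eventually_elim
      case (elim \<omega>)
      then show ?case
        using 0 w_pos[OF elim] w_le[OF elim] mult_mono[of "w (Z \<omega>)" 1 "exp (- (s * Z \<omega>))" 1]
        by simp
    qed
  qed measurable
next
  case (Suc j)
  have "AE \<omega> in M. 0 \<le> Z \<omega>" using Z_pos by eventually_elim simp
  from integrable_mult_exp[OF _ Z this Suc.IH Suc.prems] show ?case
    by (simp add: mult.assoc)
qed

lemma DERIV_wlaplace:
  assumes "s > 0"
  shows "(wlaplace M w Z j has_real_derivative - wlaplace M w Z (Suc j) s) (at s)"
proof -
  have "AE \<omega> in M. 0 \<le> Z \<omega>" using Z_pos by eventually_elim simp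
  from DERIV_laplace[OF _ Z this integrable_wlaplace assms, of j] show ?thesis
    unfolding wlaplace_def[abs_def] by (simp add: mult.assoc)
qed

lemma wlaplace_pos:
  assumes "s > 0"
  shows "wlaplace M w Z j s > 0"
  unfolding wlaplace_def
proof (rule expectation_pos[OF integrable_wlaplace[OF assms]])
  show "AE \<omega> in M. 0 < Z \<omega> ^ j * w (Z \<omega>) * exp (- (s * Z \<omega>))"
    using Z_pos by eventually_elim (simp add: w_pos)
qed

lemma wlaplace_le_1:
  assumes "s > 0"
  shows "wlaplace M w Z 0 s \<le> 1"
  unfolding wlaplace_def
proof (rule integral_le_const[OF integrable_wlaplace[OF assms]])
  show "AE \<omega> in M. Z \<omega> ^ 0 * w (Z \<omega>) * exp (- (s * Z \<omega>)) \<le> 1"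
    using Z_pos
  proof eventually_elim
    case (elim \<omega>)
    then show ?case
      using assms w_pos[OF elim] w_le[OF elim] mult_mono[of "w (Z \<omega>)" 1 "exp (- (s * Z \<omega>))" 1]
      by simp
  qed
qed

text \<open>Strict Cauchy-Schwarz: \<rho> is the mean of \<open>Z\<close> under the law tilted by
  \<open>w (Z \<omega>) * exp (- (s * Z \<omega>))\<close>, and the variance under that law is
  positive.\<close>

lemma wlaplace_1_square_less:
  assumes nd: "non_degenerate M Z" and s: "s > 0"
  shows "(wlaplace M w Z 1 s)\<^sup>2 < wlaplace M w Z 0 s * wlaplace M w Z 2 s"
proof -
  define L where "L j = wlaplace M w Z j s" for j
  define \<rho> where "\<rho> = L 1 / L 0"
  define f where "f j \<omega> = Z \<omega> ^ j * w (Z \<omega>) * exp (- (s * Z \<omega>))" for j \<omega>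
  have int: "integrable M (f j)" for j
    unfolding f_def by (rule integrable_wlaplace[OF s])
  have L: "expectation (f j) = L j" for j by (simp add: f_def[abs_def] L_def wlaplace_def)
  have L0: "L 0 > 0" unfolding L_def by (rule wlaplace_pos[OF s])
  have f_eq: "f 2 \<omega> - 2 * \<rho> * f 1 \<omega> + \<rho>\<^sup>2 * f 0 \<omega> = (Z \<omega> - \<rho>)\<^sup>2 * w (Z \<omega>) * exp (- (s * Z \<omega>))" for \<omega>
    by (simp add: f_def power2_eq_square algebra_simps)
  have intg: "integrable M (\<lambda>\<omega>. (Z \<omega> - \<rho>)\<^sup>2 * w (Z \<omega>) * exp (- (s * Z \<omega>)))"
    unfolding f_eq[symmetric] using int by simp
  have eq: "expectation (\<lambda>\<omega>. (Z \<omega> - \<rho>)\<^sup>2 * w (Z \<omega>) * exp (- (s * Z \<omega>))) = L 2 - 2 * \<rho> * L 1 + \<rho>\<^sup>2 * L 0"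
    unfolding f_eq[symmetric] using int by (simp add: L)
  have nn: "AE \<omega> in M. 0 \<le> (Z \<omega> - \<rho>)\<^sup>2 * w (Z \<omega>) * exp (- (s * Z \<omega>))"
    using Z_pos by eventually_elim (simp add: w_pos less_imp_le)
  have "expectation (\<lambda>\<omega>. (Z \<omega> - \<rho>)\<^sup>2 * w (Z \<omega>) * exp (- (s * Z \<omega>))) \<noteq> 0"
  proof
    assume "expectation (\<lambda>\<omega>. (Z \<omega> - \<rho>)\<^sup>2 * w (Z \<omega>) * exp (- (s * Z \<omega>))) = 0"
    then have "AE \<omega> in M. (Z \<omega> - \<rho>)\<^sup>2 * w (Z \<omega>) * exp (- (s * Z \<omega>)) = 0"
      using integral_nonneg_eq_0_iff_AE[OF intg nn] by simp
    with Z_pos have "AE \<omega> in M. Z \<omega> = \<rho>"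
      by eventually_elim (use w_pos in force)
    with nd show False by (auto simp: non_degenerate_def)
  qed
  with integral_nonneg_AE[OF nn] have "0 < L 2 - 2 * \<rho> * L 1 + \<rho>\<^sup>2 * L 0"
    unfolding eq by simp
  then have "0 < L 0 * (L 2 - 2 * \<rho> * L 1 + \<rho>\<^sup>2 * L 0)"
    using L0 by simp
  also have "\<dots> = L 0 * L 2 - (L 1)\<^sup>2"
    using L0 by (simp add: \<rho>_def power2_eq_square field_simps)
  finally show ?thesis by (simp add: L_def)
qed

end

text \<open>Each of the three relations evaluates one expectation twice, that of
  \<open>X ^ j / (1 + X)\<^sup>2 * exp (- (s * V))\<close>: once by independence of \<open>X\<close>
  and \<open>Y\<close>, once by independence of \<open>U\<close> and \<open>V\<close>.\<close>

lemma laplace_system_if_indep: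
  fixes X Y :: "'a \<Rightarrow> real"
  defines "U \<equiv> \<lambda>\<omega>. (1 + 1 / (X \<omega> + Y \<omega>)) / (1 + 1 / X \<omega>)" and "V \<equiv> \<lambda>\<omega>. X \<omega> + Y \<omega>"
  assumes indXY: "indep_var borel X borel Y" and indUV: "indep_var borel U borel V"
    and X_pos: "AE \<omega> in M. X \<omega> > 0" and Y_pos: "AE \<omega> in M. Y \<omega> > 0"
    and nd: "non_degenerate M Y"
  shows "laplace_system (wlaplace M (\<lambda>x. 1 / (1 + x)\<^sup>2) X) (wlaplace M (\<lambda>x. 1 / (1 + x)\<^sup>2) V)
    (wlaplace M (\<lambda>_. 1) Y 0) (wlaplace M (\<lambda>_. 1) Y 1) (wlaplace M (\<lambda>_. 1) Y 2)
    (expectation U) (expectation (\<lambda>\<omega>. (U \<omega>)\<^sup>2))"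
proof -
  have rv[measurable]: "random_variable borel X" "random_variable borel Y"
    "random_variable borel U" "random_variable borel V"
    using indep_var_rv1[OF indXY] indep_var_rv2[OF indXY] indep_var_rv1[OF indUV] indep_var_rv2[OF indUV] by auto
  have V_pos: "AE \<omega> in M. V \<omega> > 0"
    using X_pos Y_pos by eventually_elim (simp add: V_def)
  have U_bounds: "AE \<omega> in M. 0 < U \<omega> \<and> U \<omega> < 1"
    using X_pos Y_pos
  proof eventually_elim
    case (elim \<omega>)
    then have "1 / (X \<omega> + Y \<omega>) < 1 / X \<omega>" "0 < 1 / (X \<omega> + Y \<omega>)"
      by (auto intro!: divide_strict_left_mono mult_pos_pos add_pos_pos)
    moreover have "0 < (1 + p) / (1 + q) \<and> (1 + p) / (1 + q) < 1" if "0 < p" "p < q" for p q :: real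
      using that by auto
    ultimately show ?case
      unfolding U_def by blast
  qed
  have intU: "integrable M (\<lambda>\<omega>. U \<omega> ^ i)" for i
  proof (rule integrable_const_bound[where B = 1])
    show "AE \<omega> in M. norm (U \<omega> ^ i) \<le> 1"
      using U_bounds by eventually_elim (simp add: power_le_one abs_mult)
  qed measurable
  define w :: "real \<Rightarrow> real" where "w = (\<lambda>x. 1 / (1 + x)\<^sup>2)"
  have w[measurable]: "w \<in> borel_measurable borel" unfolding w_def by measurable
  have w_bounds: "0 < w z" "w z \<le> 1" if "z > 0" for z
    using that by (auto simp: w_def divide_le_eq)
  note PX = DERIV_wlaplace[OF rv(1) X_pos w w_bounds] wlaplace_pos[OF rv(1) X_pos w w_bounds]
    integrable_wlaplace[OF rv(1) X_pos w w_bounds]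
  note QV = DERIV_wlaplace[OF rv(4) V_pos w w_bounds] wlaplace_pos[OF rv(4) V_pos w w_bounds]
    integrable_wlaplace[OF rv(4) V_pos w w_bounds]
  have one: "(\<lambda>_. 1) \<in> borel_measurable (borel :: real measure)" "\<And>z::real. z > 0 \<Longrightarrow> (0::real) < 1"
     "\<And>z::real. z > 0 \<Longrightarrow> (1::real) \<le> 1" by auto
  note FY = DERIV_wlaplace[OF rv(2) Y_pos one] wlaplace_pos[OF rv(2) Y_pos one]
    integrable_wlaplace[OF rv(2) Y_pos one] wlaplace_le_1[OF rv(2) Y_pos one]
    wlaplace_1_square_less[OF rv(2) Y_pos one nd]
  define Q where "Q j s \<omega> = V \<omega> ^ j * w (V \<omega>) * exp (- (s * V \<omega>))" for j s \<omega>
  have UQ: "expectation (\<lambda>\<omega>. U \<omega> ^ i * Q j s \<omega>) = expectation (\<lambda>\<omega>. U \<omega> ^ i) * wlaplace M w V j s"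
    and intUQ: "integrable M (\<lambda>\<omega>. U \<omega> ^ i * Q j s \<omega>)" if "s > 0" for i j s
    unfolding wlaplace_def Q_def
    by (rule indep_var_expectation_mult[OF indUV, of "\<lambda>u. u ^ i" "\<lambda>v. v ^ j * w v * exp (- (s * v))"];
        use intU QV(3) that in measurable)+
  have FP: "wlaplace M (\<lambda>_. 1) Y 0 s * wlaplace M w X j s
      = expectation (\<lambda>\<omega>. X \<omega> ^ j * w (X \<omega>) * exp (- (s * V \<omega>)))" if s: "s > 0" for j s
  proof -
    have "expectation (\<lambda>\<omega>. X \<omega> ^ j * w (X \<omega>) * exp (- (s * V \<omega>)))
      = expectation (\<lambda>\<omega>. (X \<omega> ^ j * w (X \<omega>) * exp (- (s * X \<omega>))) * (Y \<omega> ^ 0 * 1 * exp (- (s * Y \<omega>))))"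
      by (simp add: V_def algebra_simps flip: exp_add)
    also have "\<dots> = wlaplace M w X j s * wlaplace M (\<lambda>_. 1) Y 0 s"
      unfolding wlaplace_def
      by (rule indep_var_expectation_mult[OF indXY, of "\<lambda>x. x ^ j * w x * exp (- (s * x))" "\<lambda>y. y ^ 0 * 1 * exp (- (s * y))"];
          use PX(3) FY(3) s in measurable)
    finally show ?thesis by simp
  qed
  \<comment> \<open>These are the squares and the product of
    \<open>1 / (1 + X) = (1 + (1 - U) V) / (1 + V)\<close> and
    \<open>X / (1 + X) = U V / (1 + V)\<close>.\<close>
  have sub: "AE \<omega> in M. w (X \<omega>) = (1 + (1 - U \<omega>) * V \<omega>)\<^sup>2 * w (V \<omega>)
      \<and> X \<omega> * w (X \<omega>) = U \<omega> * V \<omega> * (1 + (1 - U \<omega>) * V \<omega>) * w (V \<omega>)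
      \<and> (X \<omega>)\<^sup>2 * w (X \<omega>) = (U \<omega> * V \<omega>)\<^sup>2 * w (V \<omega>)"
    using X_pos Y_pos
  proof eventually_elim
    case (elim \<omega>)
    define x v where "x = X \<omega>" and "v = V \<omega>"
    have pos: "x > 0" "v > 0" "1 + x > 0" "1 + v > 0"
      using elim by (auto simp: x_def v_def V_def)
    have "U \<omega> = (1 + 1 / v) / (1 + 1 / x)" by (simp add: U_def x_def v_def V_def)
    also have "\<dots> = ((1 + v) / v) / ((1 + x) / x)"
      using pos by (simp add: add_divide_distrib add.commute)
    finally have UV: "U \<omega> * v = x * ((1 + v) / (1 + x))"
      using pos by simp
    have UV': "1 + (1 - U \<omega>) * v = (1 + v) / (1 + x)"
    proof -
      have "1 + (1 - U \<omega>) * v = 1 + v - U \<omega> * v" by (simp add: algebra_simps)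
      also have "\<dots> = (1 + v) / (1 + x)" unfolding UV using pos by (simp add: field_simps)
      finally show ?thesis .
    qed
    have "w x = ((1 + v) / (1 + x))\<^sup>2 * w v"
      using pos by (simp add: w_def power_divide)
    then show ?case
      unfolding x_def[symmetric] v_def[symmetric] UV UV' by (simp add: power2_eq_square)
  qed
  show ?thesis
    unfolding w_def[symmetric]
  proof
    fix s :: real assume s: "s > 0"
    let ?Q = "wlaplace M w V" and ?c1 = "expectation U" and ?c2 = "expectation (\<lambda>\<omega>. (U \<omega>)\<^sup>2)"
    have UQ0: "expectation (Q j s) = ?Q j s" "integrable M (Q j s)" for j
      using UQ[OF s, of 0 j] intUQ[OF s, of 0 j] by (simp_all add: prob_space)
    have UQ1: "expectation (\<lambda>\<omega>. U \<omega> * Q j s \<omega>) = ?c1 * ?Q j s" "integrable M (\<lambda>\<omega>. U \<omega> * Q j s \<omega>)" for j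
      using UQ[OF s, of 1 j] intUQ[OF s, of 1 j] by simp_all
    note UQ2 = UQ[OF s, of 2] intUQ[OF s, of 2]
    have "expectation (\<lambda>\<omega>. X \<omega> ^ 0 * w (X \<omega>) * exp (- (s * V \<omega>)))
      = expectation (\<lambda>\<omega>. Q 0 s \<omega> + 2 * (Q 1 s \<omega> - U \<omega> * Q 1 s \<omega>) + (Q 2 s \<omega> - 2 * (U \<omega> * Q 2 s \<omega>) + (U \<omega>)\<^sup>2 * Q 2 s \<omega>))"
    proof (rule integral_cong_AE)
      show "AE \<omega> in M. X \<omega> ^ 0 * w (X \<omega>) * exp (- (s * V \<omega>)) = Q 0 s \<omega> + 2 * (Q 1 s \<omega> - U \<omega> * Q 1 s \<omega>) + (Q 2 s \<omega> - 2 * (U \<omega> * Q 2 s \<omega>) + (U \<omega>)\<^sup>2 * Q 2 s \<omega>)"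
        using sub
      proof eventually_elim
        case (elim \<omega>)
        then have eq: "X \<omega> ^ 0 * w (X \<omega>) = (1 + (1 - U \<omega>) * V \<omega>)\<^sup>2 * w (V \<omega>)"
          unfolding power_0 power_one_right mult_1 by blast
        show ?case
          unfolding eq Q_def by (simp add: power2_eq_square algebra_simps)
      qed
    qed (unfold Q_def, measurable)
    also have "\<dots> = ?Q 0 s + 2 * (?Q 1 s - ?c1 * ?Q 1 s) + (?Q 2 s - 2 * (?c1 * ?Q 2 s) + ?c2 * ?Q 2 s)"
      by (simp add: UQ0 UQ1 UQ2)
    finally show "wlaplace M (\<lambda>_. 1) Y 0 s * wlaplace M w X 0 s
        = ?Q 0 s + 2 * (1 - ?c1) * ?Q 1 s + (1 - 2 * ?c1 + ?c2) * ?Q 2 s"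
      unfolding FP[OF s] by (simp add: algebra_simps)
    have "expectation (\<lambda>\<omega>. X \<omega> ^ 1 * w (X \<omega>) * exp (- (s * V \<omega>)))
      = expectation (\<lambda>\<omega>. U \<omega> * Q 1 s \<omega> + (U \<omega> * Q 2 s \<omega> - (U \<omega>)\<^sup>2 * Q 2 s \<omega>))"
    proof (rule integral_cong_AE)
      show "AE \<omega> in M. X \<omega> ^ 1 * w (X \<omega>) * exp (- (s * V \<omega>)) = U \<omega> * Q 1 s \<omega> + (U \<omega> * Q 2 s \<omega> - (U \<omega>)\<^sup>2 * Q 2 s \<omega>)"
        using sub
      proof eventually_elim
        case (elim \<omega>)
        then have eq: "X \<omega> ^ 1 * w (X \<omega>) = U \<omega> * V \<omega> * (1 + (1 - U \<omega>) * V \<omega>) * w (V \<omega>)"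
          unfolding power_0 power_one_right mult_1 by blast
        show ?case
          unfolding eq Q_def by (simp add: power2_eq_square algebra_simps)
      qed
    qed (unfold Q_def, measurable)
    also have "\<dots> = ?c1 * ?Q 1 s + (?c1 * ?Q 2 s - ?c2 * ?Q 2 s)"
      by (simp add: UQ1 UQ2)
    finally show "wlaplace M (\<lambda>_. 1) Y 0 s * wlaplace M w X 1 s
        = ?c1 * ?Q 1 s + (?c1 - ?c2) * ?Q 2 s"
      unfolding FP[OF s] by (simp add: algebra_simps)
    have "expectation (\<lambda>\<omega>. X \<omega> ^ 2 * w (X \<omega>) * exp (- (s * V \<omega>)))
      = expectation (\<lambda>\<omega>. (U \<omega>)\<^sup>2 * Q 2 s \<omega>)"
    proof (rule integral_cong_AE)
      show "AE \<omega> in M. X \<omega> ^ 2 * w (X \<omega>) * exp (- (s * V \<omega>)) = (U \<omega>)\<^sup>2 * Q 2 s \<omega>"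
        using sub
      proof eventually_elim
        case (elim \<omega>)
        then have eq: "X \<omega> ^ 2 * w (X \<omega>) = (U \<omega> * V \<omega>)\<^sup>2 * w (V \<omega>)"
          unfolding power_0 power_one_right mult_1 by blast
        show ?case
          unfolding eq Q_def by (simp add: power_mult_distrib algebra_simps)
      qed
    qed (unfold Q_def, measurable)
    then show "wlaplace M (\<lambda>_. 1) Y 0 s * wlaplace M w X 2 s = ?c2 * ?Q 2 s"
      unfolding FP[OF s] UQ2 .
  next
    \<comment> \<open>The strict bounds on the moments of \<open>U\<close> are positive expectations
      of \<open>U\<^sup>2\<close>, \<open>U - U\<^sup>2\<close> and \<open>1 - U\<close>, as
      \<open>U\<close> lies in (0, 1) almost surely.\<close>
    have AE: "AE \<omega> in M. 0 < U \<omega> ^ 2" "AE \<omega> in M. 0 < U \<omega> ^ 1 - U \<omega> ^ 2" "AE \<omega> in M. 0 < 1 - U \<omega> ^ 1"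
      using U_bounds by (eventually_elim, simp add: power2_eq_square)+
    show "0 < expectation (\<lambda>\<omega>. (U \<omega>)\<^sup>2)"
      by (rule expectation_pos[OF intU AE(1)])
    show "expectation (\<lambda>\<omega>. (U \<omega>)\<^sup>2) < expectation U"
      using expectation_pos[OF Bochner_Integration.integrable_diff[OF intU intU] AE(2)] intU[of 1] intU[of 2]
      by simp
    show "expectation U < 1"
      using expectation_pos[OF Bochner_Integration.integrable_diff[OF integrable_const intU] AE(3)] intU[of 1]
      by (simp add: prob_space)
  qed (use PX(1,2) QV(1,2) FY(1)[where j = 0] FY(1)[where j = 1] FY(2,4,5) in \<open>auto simp: numeral_2_eq_2\<close>)
qed

end

section \<open>Identification of the laws of \<open>X\<close> and \<open>Y\<close>\<close>

theorem corollary3p5: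
  fixes M :: "'a measure" and X Y :: "'a \<Rightarrow> real"
  assumes "prob_space M"
    and "prob_space.indep_var M borel X borel Y"
    and "AE \<omega> in M. X \<omega> > 0"
    and "AE \<omega> in M. Y \<omega> > 0"
    and "non_degenerate M X"
    and "non_degenerate M Y"
    and "prob_space.indep_var M
           borel (\<lambda>\<omega>. (1 + 1 / (X \<omega> + Y \<omega>)) / (1 + 1 / X \<omega>))
           borel (\<lambda>\<omega>. X \<omega> + Y \<omega>)"
  shows "kummer_distribution (distr M borel X) \<and> gamma_distribution (distr M borel Y)"
proof -
  interpret prob_space M by fact
  have [measurable]: "random_variable borel X" "random_variable borel Y"
    using indep_var_rv1[OF assms(2)] indep_var_rv2[OF assms(2)] by auto
  define w :: "real \<Rightarrow> real" where "w = (\<lambda>x. 1 / (1 + x)\<^sup>2)"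
  have w[measurable]: "w \<in> borel_measurable borel" unfolding w_def by measurable
  have w_bounds: "0 < w z" "w z \<le> 1" if "z > 0" for z
    using that by (auto simp: w_def divide_le_eq)
  define P where "P = wlaplace M w X"
  define F where "F = wlaplace M (\<lambda>_. 1) Y"
  define c1 c2 where "c1 = expectation (\<lambda>\<omega>. (1 + 1 / (X \<omega> + Y \<omega>)) / (1 + 1 / X \<omega>))"
    and "c2 = expectation (\<lambda>\<omega>. ((1 + 1 / (X \<omega> + Y \<omega>)) / (1 + 1 / X \<omega>))\<^sup>2)"
  interpret laplace_system P "wlaplace M w (\<lambda>\<omega>. X \<omega> + Y \<omega>)" "F 0" "F 1" "F 2" c1 c2
    unfolding P_def F_def w_def c1_def c2_def
    by (rule laplace_system_if_indep[OF assms(2,7,3,4,6)])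
  obtain c where c: "c > 0" and FR: "\<And>s. s > 0 \<Longrightarrow> F 0 s = \<kappa> * (s + c) * F 1 s"
    by (rule F_over_R) blast
  have X_AE: "AE x in distr M borel X. x > 0" and Y_AE: "AE x in distr M borel Y. x > 0"
    using assms(3,4) by (simp_all add: AE_distr_iff)
  have density_AE: "AE x in density lborel (\<lambda>x. ennreal (K * kummer_fun \<alpha> p c x)). x > 0" for K \<alpha> p
    by (subst AE_density) (auto simp: kummer_fun_def indicator_def)
  \<comment> \<open>The shift by \<open>c\<close> arises because a kernel of rate \<open>c\<close>
    has, at \<open>s\<close>, the transform \<open>kummer_integral\<close> at
    \<open>s + c\<close>.\<close>
  have dI: "((\<lambda>s. kummer_integral \<alpha> p (s + c)) has_real_derivative - kummer_integral (\<alpha> + 1) p (s + c)) (at s)"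
    if "\<alpha> > -1" "s > 0" for \<alpha> p s
    using DERIV_kummer_integral[OF that(1), of "s + c" p] that c by (simp add: DERIV_shift)
  have I_pos: "kummer_integral \<alpha> p (s + c) > 0" if "\<alpha> > -1" "s > 0" for \<alpha> p s
    unfolding kummer_integral_def using that c by (intro kummer_fun_integral_pos) auto
  \<comment> \<open>The equation \<open>F = \<kappa> (s + c) R\<close> with \<open>R = - F'\<close>
    is solved by \<open>(s + c) powr (- 1 / \<kappa>)\<close>, up to a constant the transform of a
    gamma law of shape \<open>1 / \<kappa>\<close>.\<close>
  define b where "b = 1 / \<kappa>"
  have b: "b > 0" "b * \<kappa> = 1" using \<kappa>_pos by (simp_all add: b_def)

  have "gamma_distribution (distr M borel Y)"
  proof -
    define h where "h j s = kummer_integral (b - 1 + real j) 0 (s + c)" for j s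
    \<comment> \<open>For \<open>p = 0\<close> integration by parts says that \<open>h 0\<close> has
      logarithmic derivative \<open>- b / (s + c)\<close>, the same as \<open>F 0\<close>.\<close>
    have parts: "b * h 0 s = (s + c) * h 1 s" if "s > 0" for s
      using kummer_fun_by_parts[of b "s + c" 0] b c that by (simp add: h_def kummer_integral_def)
    obtain K where K: "K > 0" "\<And>s. s > 0 \<Longrightarrow> F 0 s = K * h 0 s"
    proof (rule proportional_if_log_deriv_eq[of "F 0" "\<lambda>s. - F 1 s" "h 0" "\<lambda>s. - h 1 s"])
      fix s :: real assume s: "s > 0"
      show "(h 0 has_real_derivative - h 1 s) (at s)"
        using dI[of "b - 1" s 0] b s by (simp add: h_def[abs_def])
      show "h 0 s > 0" using I_pos[of "b - 1" s 0] b s by (simp add: h_def)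
      have "F 0 s * h 1 s = \<kappa> * F 1 s * ((s + c) * h 1 s)"
        using FR[OF s] by simp
      also have "\<dots> = (b * \<kappa>) * (F 1 s * h 0 s)"
        unfolding parts[OF s, symmetric] by simp
      finally show "- F 1 s * h 0 s = F 0 s * - h 1 s" by (simp add: b)
    qed (use dF F_pos in auto)
    have "distr M borel Y = density lborel (\<lambda>x. ennreal (K * gamma_kernel b c x))"
      unfolding gamma_kernel_eq_kummer_fun
    proof (rule measure_eq_if_weighted_laplace_eq[where w = "\<lambda>_. 1"])
      fix s :: real assume s: "s > 0"
      have eq: "K * kummer_fun (b - 1) 0 c x * exp (- (s * x)) = K * kummer_fun (b - 1) 0 (s + c) x" for x
        using kummer_fun_mult_exp[of "b - 1" 0 c x s] by (simp add: add.commute)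
      have int: "integrable lborel (kummer_fun (b - 1) 0 (s + c))"
        using b c s by (intro integrable_kummer_fun) auto
      show "integrable (distr M borel Y) (\<lambda>x. 1 * exp (- (s * x)))"
        using integrable_wlaplace[of Y "\<lambda>_. 1" s 0] assms(4) s by (simp add: integrable_distr_eq)
      show "integrable (density lborel (\<lambda>x. ennreal (K * kummer_fun (b - 1) 0 c x))) (\<lambda>x. 1 * exp (- (s * x)))"
        using K int by (subst integrable_density) (auto simp: kummer_fun_nonneg eq)
      have "(\<integral>x. 1 * exp (- (s * x)) \<partial>distr M borel Y) = F 0 s"
        by (simp add: integral_distr F_def wlaplace_def)
      also have "\<dots> = (\<integral>x. K * kummer_fun (b - 1) 0 c x * exp (- (s * x)) \<partial>lborel)"
        unfolding eq using K(2)[OF s] by (simp add: h_def kummer_integral_def)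
      also have "\<dots> = (\<integral>x. 1 * exp (- (s * x)) \<partial>density lborel (\<lambda>x. ennreal (K * kummer_fun (b - 1) 0 c x)))"
        using K by (subst integral_density) (auto simp: kummer_fun_nonneg)
      finally show "(\<integral>x. 1 * exp (- (s * x)) \<partial>distr M borel Y)
        = (\<integral>x. 1 * exp (- (s * x)) \<partial>density lborel (\<lambda>x. ennreal (K * kummer_fun (b - 1) 0 c x)))" .
    qed (use Y_AE density_AE in \<open>auto intro: prob_space_distr\<close>)
    then show ?thesis
      unfolding gamma_distribution_def prob_density_proportional_to_def
      using b c K(1) prob_space_distr[of Y borel] by auto
  qed

  moreover have "kummer_distribution (distr M borel X)"
  proof -
    define g where "g = c2 / e"
    define a where "a = g / \<kappa> - 1"
    have a: "a > 0" using shape_pos by (simp add: a_def g_def)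
    have g: "g = \<kappa> * (a + 1)" using \<kappa>_pos by (simp add: a_def)
    \<comment> \<open>Integration by parts for \<open>h\<close> matches the equation for
      \<open>P\<close> exactly when \<open>a + 1 = g / \<kappa>\<close> and
      \<open>\<kappa> * (a + p + 2) = - 1\<close>. The exponent \<open>q\<close> of the law itself
      exceeds \<open>p\<close> by 2 because of the weight
      \<open>1 / (1 + x)\<^sup>2\<close>.\<close>
    define q p where "q = - (a + b)" and "p = q - 2"
    \<comment> \<open>Off by one: \<open>h j\<close> corresponds to \<open>P (Suc j)\<close>, since
      \<open>h 0\<close> already contains the factor \<open>x\<close> on top of the power
      \<open>a - 1\<close> of the Kummer kernel.\<close>
    define h where "h j s = kummer_integral (a + real j) p (s + c)" for j s
    have dh: "(h j has_real_derivative - h (Suc j) s) (at s)" if "s > 0" for j s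
      using dI[of "a + real j" s p] a that by (simp add: h_def[abs_def] add_ac)
    have h_pos: "h j s > 0" if "s > 0" for j s
      using I_pos[of "a + real j" s p] a that by (simp add: h_def)
    have h_ode: "g * h 0 s - h 1 s = \<kappa> * (s + c) * (h 1 s + h 2 s)" if s: "s > 0" for s
    proof -
      \<comment> \<open>The exponents \<open>a + 1\<close> and \<open>p + 1\<close> are chosen so
        that expanding a factor \<open>1 + x\<close> expresses every term through
        \<open>h 0\<close>, \<open>h 1\<close> and \<open>h 2\<close>.\<close>
      have "(a + 1) * kummer_integral a (p + 1) (s + c) + (p + 1) * kummer_integral (a + 1) p (s + c)
          = (s + c) * kummer_integral (a + 1) (p + 1) (s + c)"
        using kummer_fun_by_parts[of "a + 1" "s + c" "p + 1"] a c s by (simp add: kummer_integral_def)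
      then have "(a + 1) * (h 0 s + h 1 s) + (p + 1) * h 1 s = (s + c) * (h 1 s + h 2 s)"
        using a c s by (simp add: kummer_integral_mult_one_plus h_def add.assoc)
      then have "\<kappa> * ((a + 1) * (h 0 s + h 1 s) + (p + 1) * h 1 s) = \<kappa> * ((s + c) * (h 1 s + h 2 s))"
        by simp
      also have "\<kappa> * ((a + 1) * (h 0 s + h 1 s) + (p + 1) * h 1 s) = g * h 0 s - (b * \<kappa>) * h 1 s"
        unfolding g p_def q_def by (simp add: algebra_simps)
      finally show ?thesis by (simp add: b mult.assoc)
    qed
    have P_ode: "g * P 1 s - P 2 s = \<kappa> * (s + c) * (P 2 s + P 3 s)" if s: "s > 0" for s
    proof -
      have "F 1 s * (g * P 1 s - P 2 s) = F 1 s * (\<kappa> * (s + c) * (P 2 s + P 3 s))"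
        using ode_P[OF s] FR[OF s] by (simp add: g_def mult_ac)
      then show ?thesis using R_pos[OF s] by simp
    qed
    obtain K where K: "K > 0" "\<And>s. s > 0 \<Longrightarrow> P 1 s = K * h 0 s"
    proof (rule proportional_if_second_order_ode[of "P 1" "P 2" "P 3" "h 0" "h 1" "h 2" \<kappa> c g])
      show "(P 1 has_real_derivative - P 2 s) (at s)" "(P 2 has_real_derivative - P 3 s) (at s)"
        "(h 0 has_real_derivative - h 1 s) (at s)" "(h 1 has_real_derivative - h 2 s) (at s)" if "s > 0" for s
        using dP[OF that, of 1] dP[OF that, of 2] dh[OF that, of 0] dh[OF that, of 1]
        by (simp_all add: eval_nat_numeral)
    qed (use P_pos h_pos P_ode h_ode \<kappa>_pos c in \<open>auto intro: less_imp_le\<close>)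
    have "distr M borel X = density lborel (\<lambda>x. ennreal (K * kummer_kernel a b c x))"
      unfolding kummer_kernel_eq_kummer_fun q_def[symmetric]
    \<comment> \<open>The weight is \<open>x / (1 + x)\<^sup>2\<close> because the transform
      identified up to a constant is \<open>P 1\<close>.\<close>
    proof (rule measure_eq_if_weighted_laplace_eq[where w = "\<lambda>x. x * w x"])
      fix s :: real assume s: "s > 0"
      have eq: "K * kummer_fun (a - 1) q c x * (x * w x * exp (- (s * x)))
          = K * kummer_fun a p (s + c) x" for x
      proof (cases "x > 0")
        case True
        have "kummer_fun (a - 1) q c x = (1 + x) * ((1 + x) * kummer_fun (a - 1) p c x)"
          by (simp add: kummer_fun_mult_one_plus p_def)
        then have "kummer_fun (a - 1) q c x * w x = kummer_fun (a - 1) p c x"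
          using True by (simp add: w_def power2_eq_square)
        moreover have "x * kummer_fun (a - 1) p c x * exp (- (s * x)) = kummer_fun a p (s + c) x"
          using kummer_fun_mult_power[of x 1 "a - 1" p c] kummer_fun_mult_exp[of a p c x s]
          by (simp add: add.commute)
        moreover have "K * kummer_fun (a - 1) q c x * (x * w x * exp (- (s * x)))
            = K * (x * (kummer_fun (a - 1) q c x * w x) * exp (- (s * x)))"
          by (simp only: mult_ac)
        ultimately show ?thesis by (simp only:)
      qed (simp add: kummer_fun_def)
      have int: "integrable lborel (kummer_fun a p (s + c))"
        using a c s by (intro integrable_kummer_fun) auto
      show "integrable (distr M borel X) (\<lambda>x. x * w x * exp (- (s * x)))"
        using integrable_wlaplace[of X w s 1] assms(3) w_bounds s by (subst integrable_distr_eq) simp_all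
      show "integrable (density lborel (\<lambda>x. ennreal (K * kummer_fun (a - 1) q c x))) (\<lambda>x. x * w x * exp (- (s * x)))"
        using K int by (subst integrable_density) (auto simp: kummer_fun_nonneg eq)
      have "(\<integral>x. x * w x * exp (- (s * x)) \<partial>distr M borel X) = P 1 s"
        by (subst integral_distr) (auto simp: P_def wlaplace_def)
      also have "\<dots> = (\<integral>x. K * kummer_fun (a - 1) q c x * (x * w x * exp (- (s * x))) \<partial>lborel)"
        unfolding eq using K(2)[OF s] by (simp add: h_def kummer_integral_def)
      also have "\<dots> = (\<integral>x. x * w x * exp (- (s * x)) \<partial>density lborel (\<lambda>x. ennreal (K * kummer_fun (a - 1) q c x)))"
        using K by (subst integral_density) (auto simp: kummer_fun_nonneg)
      finally show "(\<integral>x. x * w x * exp (- (s * x)) \<partial>distr M borel X)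
        = (\<integral>x. x * w x * exp (- (s * x)) \<partial>density lborel (\<lambda>x. ennreal (K * kummer_fun (a - 1) q c x)))" .
    qed (use X_AE density_AE w_bounds in \<open>auto intro: prob_space_distr\<close>)
    then show ?thesis
      unfolding kummer_distribution_def prob_density_proportional_to_def
      using a c K(1) prob_space_distr[of X borel] by auto
  qed
  ultimately show ?thesis by blast
qed

end
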